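(* The only (connected, maximal) parabolic h-grim reapers of $\mathbb{H}^2\times\mathbb{R}$ are the slices $\mathbb{H}^2\times\{z_0\}$, $z_0\in\mathbb{R}$, and the surfaces parametrized by $\Psi(s,t)=(t,y(s),z(s))$, $s,t\in\mathbb{R}$, where the generating curve is (up to reparametrization) $$\alpha(s)=(y(s),z(s))=2\left(c_1\cosh(s),\ c_2+\tan^{-1}e^s\right),\qquad c_1,c_2\in\mathbb{R},\ c_1>0.$$ Each surface of the latter kind is a bi-graph and is contained between two slices $\mathbb{H}^2\times\{z_1\}$ and $\mathbb{H}^2\times\{z_2\}$ (for some $z_1<z_2$), to which it is asymptotic.
   Context: $\mathbb{H}^2\times\mathbb{R}$ is $\{(x,y,z)\in\mathbb{R}^3: y>0\}$ with metric $\frac{dx^2+dy^2}{y^2}+dz^2$. For an orientable immersed surface $\Sigma$ with unit normal $N$, $H$ denotes the mean curvature with respect to $N$, i.e. half the trace of the second fundamental form $\langle N,\overline\nabla_{\cdot}\,\cdot\rangle$. $\Sigma$ is an h-translator if $H=\langle N,x\partial_x+y\partial_y\rangle$. A parabolic h-grim reaper is an h-translator invariant by all parabolic translations $(x,y,z)\mapsto(x+t,y,z)$, $t\in\mathbb{R}$; it is parametrized by $\Psi(s,t)=(t,y(s),z(s))$ with generating curve $\alpha(s)=(y(s),z(s))$. "Maximal" means that the generating curve is not properly extendable within the same class. "Bi-graph" means the union of two graphs of $z$ over domains of the $xy$-plane meeting along their common boundary. *)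

theory Defs
  imports "HOL-Analysis.Analysis"
begin

section \<open>Smooth maps and partial derivatives\<close>

text \<open>Meant for open \<open>U\<close> in a finite-dimensional domain. All directional derivatives
  have the type of \<open>f\<close> itself, so the recursion needs no change of type.\<close>

fun Ck_on :: "nat \<Rightarrow> 'a::real_normed_vector set \<Rightarrow> ('a \<Rightarrow> 'b::real_normed_vector) \<Rightarrow> bool" where
  "Ck_on 0 U f \<longleftrightarrow> continuous_on U f"
| "Ck_on (Suc k) U f \<longleftrightarrow>
     (\<forall>x\<in>U. f differentiable (at x)) \<and>
     (\<forall>v. Ck_on k U (\<lambda>x. frechet_derivative f (at x) v))"

definition smooth_on :: "'a::real_normed_vector set \<Rightarrow> ('a \<Rightarrow> 'b::real_normed_vector) \<Rightarrow> bool" where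
  "smooth_on U f \<longleftrightarrow> (\<forall>k. Ck_on k U f)"

definition pd :: "'n::finite \<Rightarrow> (real^'n \<Rightarrow> 'b::real_normed_vector) \<Rightarrow> real^'n \<Rightarrow> 'b" where
  "pd i f u = frechet_derivative f (at u) (axis i 1)"


section \<open>The Riemannian manifold H2xR\<close>

definition H2R :: "(real^3) set" where
  "H2R = {p. p $ 2 > 0}"

definition gmat :: "real^3 \<Rightarrow> real^3^3" where
  "gmat p = (\<chi> i j. if i = j then (if i = 3 then 1 else 1 / (p $ 2)\<^sup>2) else 0)"

definition metric :: "real^3 \<Rightarrow> real^3 \<Rightarrow> real^3 \<Rightarrow> real" where
  "metric p v w = (\<Sum>i\<in>UNIV. \<Sum>j\<in>UNIV. gmat p $ i $ j * v $ i * w $ j)"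

text \<open>Christoffel symbols of the Levi-Civita connection; \<open>k\<close> is the upper index.\<close>

definition christoffel :: "3 \<Rightarrow> 3 \<Rightarrow> 3 \<Rightarrow> real^3 \<Rightarrow> real" where
  "christoffel k i j p =
     (1/2) * (\<Sum>l\<in>UNIV. matrix_inv (gmat p) $ k $ l *
        (pd i (\<lambda>q. gmat q $ j $ l) p + pd j (\<lambda>q. gmat q $ i $ l) p
          - pd l (\<lambda>q. gmat q $ i $ j) p))"

definition dilation_field :: "real^3 \<Rightarrow> real^3" where
  "dilation_field p = vector [p $ 1, p $ 2, 0]"

definition parabolic_translation :: "real \<Rightarrow> real^3 \<Rightarrow> real^3" where
  "parabolic_translation t p = vector [p $ 1 + t, p $ 2, p $ 3]"

definition slice :: "real \<Rightarrow> (real^3) set" where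
  "slice z0 = {p \<in> H2R. p $ 3 = z0}"


section \<open>Parametrized immersed surfaces, mean curvature, h-translators\<close>

definition immersion_on :: "(real^2) set \<Rightarrow> (real^2 \<Rightarrow> real^3) \<Rightarrow> bool" where
  "immersion_on U X \<longleftrightarrow> smooth_on U X \<and> X ` U \<subseteq> H2R \<and>
     (\<forall>u\<in>U. inj (frechet_derivative X (at u)))"

definition unit_normal_on ::
  "(real^2) set \<Rightarrow> (real^2 \<Rightarrow> real^3) \<Rightarrow> (real^2 \<Rightarrow> real^3) \<Rightarrow> bool" where
  "unit_normal_on U X N \<longleftrightarrow> smooth_on U N \<and>
     (\<forall>u\<in>U. metric (X u) (N u) (N u) = 1 \<and> (\<forall>i. metric (X u) (N u) (pd i X u) = 0))"

definition first_form :: "(real^2 \<Rightarrow> real^3) \<Rightarrow> real^2 \<Rightarrow> real^2^2" where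
  "first_form X u = (\<chi> i j. metric (X u) (pd i X u) (pd j X u))"

text \<open>The ambient covariant derivative of the \<open>j\<close>-th coordinate field of \<open>X\<close> in the
  direction of the \<open>i\<close>-th one.\<close>

definition cov_deriv :: "(real^2 \<Rightarrow> real^3) \<Rightarrow> 2 \<Rightarrow> 2 \<Rightarrow> real^2 \<Rightarrow> real^3" where
  "cov_deriv X i j u = pd i (pd j X) u +
     (\<chi> k. \<Sum>a\<in>UNIV. \<Sum>b\<in>UNIV. christoffel k a b (X u) * pd i X u $ a * pd j X u $ b)"

definition second_form ::
  "(real^2 \<Rightarrow> real^3) \<Rightarrow> (real^2 \<Rightarrow> real^3) \<Rightarrow> real^2 \<Rightarrow> real^2^2" where
  "second_form X N u = (\<chi> i j. metric (X u) (N u) (cov_deriv X i j u))"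

definition mean_curvature ::
  "(real^2 \<Rightarrow> real^3) \<Rightarrow> (real^2 \<Rightarrow> real^3) \<Rightarrow> real^2 \<Rightarrow> real" where
  "mean_curvature X N u = (1/2) * trace (matrix_inv (first_form X u) ** second_form X N u)"

definition h_translator :: "(real^2) set \<Rightarrow> (real^2 \<Rightarrow> real^3) \<Rightarrow> bool" where
  "h_translator U X \<longleftrightarrow> open U \<and> immersion_on U X \<and>
     (\<exists>N. unit_normal_on U X N \<and>
       (\<forall>u\<in>U. mean_curvature X N u = metric (X u) (N u) (dilation_field (X u))))"


section \<open>Parabolic h-grim reapers\<close>

definition Psi :: "(real \<Rightarrow> real \<times> real) \<Rightarrow> real^2 \<Rightarrow> real^3" where
  "Psi \<alpha> u = vector [u $ 2, fst (\<alpha> (u $ 1)), snd (\<alpha> (u $ 1))]"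

definition strip :: "real set \<Rightarrow> (real^2) set" where
  "strip I = {u. u $ 1 \<in> I}"

definition parabolic_h_grim_reaper :: "real set \<Rightarrow> (real \<Rightarrow> real \<times> real) \<Rightarrow> bool" where
  "parabolic_h_grim_reaper I \<alpha> \<longleftrightarrow>
     open I \<and> is_interval I \<and> I \<noteq> {} \<and> h_translator (strip I) (Psi \<alpha>)"

lemma parabolic_translation_invariant:
  "parabolic_translation r ` (Psi \<alpha> ` strip I) = Psi \<alpha> ` strip I"
proof -
  have sub: "parabolic_translation r ` (Psi \<alpha> ` strip I) \<subseteq> Psi \<alpha> ` strip I" for r
  proof clarify
    fix u :: "real^2" assume "u \<in> strip I"
    then have "(vector [u $ 1, u $ 2 + r] :: real^2) \<in> strip I"
      and "parabolic_translation r (Psi \<alpha> u) = Psi \<alpha> (vector [u $ 1, u $ 2 + r])"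
      by (auto simp: strip_def parabolic_translation_def Psi_def vector_2 vector_3)
    then show "parabolic_translation r (Psi \<alpha> u) \<in> Psi \<alpha> ` strip I" by blast
  qed
  have "p = parabolic_translation r (parabolic_translation (- r) p)" for p
    by (auto simp: parabolic_translation_def vec_eq_iff forall_3 vector_3)
  with sub[of r] sub[of "- r"] show ?thesis by blast
qed

text \<open>\<open>\<alpha>\<close> on the interval \<open>I\<close> is obtained from \<open>\<beta>\<close> on the interval \<open>J\<close> by a regular change of
  parameter, possibly reversing the orientation.\<close>

definition reparametrizes ::
  "real set \<Rightarrow> (real \<Rightarrow> real \<times> real) \<Rightarrow> real set \<Rightarrow> (real \<Rightarrow> real \<times> real) \<Rightarrow> bool" where
  "reparametrizes I \<alpha> J \<beta> \<longleftrightarrow> open I \<and> is_interval I \<and>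
     (\<exists>\<phi>. smooth_on I \<phi> \<and> (\<forall>s\<in>I. deriv \<phi> s \<noteq> 0) \<and> bij_betw \<phi> I J \<and> (\<forall>s\<in>I. \<alpha> s = \<beta> (\<phi> s)))"

text \<open>Extensions are taken up to reparametrization: a curve defined on the whole line, or one
  whose parametrization degenerates at an end of \<open>I\<close>, may still be extendable.\<close>

definition maximal_parabolic_h_grim_reaper :: "real set \<Rightarrow> (real \<Rightarrow> real \<times> real) \<Rightarrow> bool" where
  "maximal_parabolic_h_grim_reaper I \<alpha> \<longleftrightarrow> parabolic_h_grim_reaper I \<alpha> \<and>
     \<not> (\<exists>J \<beta> J'. parabolic_h_grim_reaper J \<beta> \<and> J' \<subset> J \<and> reparametrizes I \<alpha> J' \<beta>)"

definition slice_curve :: "real \<Rightarrow> real \<Rightarrow> real \<times> real" where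
  "slice_curve z0 y = (y, z0)"

definition grim_curve :: "real \<Rightarrow> real \<Rightarrow> real \<Rightarrow> real \<times> real" where
  "grim_curve c1 c2 s = 2 *\<^sub>R (c1 * cosh s, c2 + arctan (exp s))"

definition grim_surface :: "real \<Rightarrow> real \<Rightarrow> (real^3) set" where
  "grim_surface c1 c2 = Psi (grim_curve c1 c2) ` strip UNIV"


section \<open>Bi-graphs and asymptotic behaviour\<close>

definition halfplane :: "(real^2) set" where
  "halfplane = {w. w $ 2 > 0}"

definition graph_over :: "(real^2) set \<Rightarrow> (real^2 \<Rightarrow> real) \<Rightarrow> (real^3) set" where
  "graph_over D f = (\<lambda>w. vector [w $ 1, w $ 2, f w]) ` D"

text \<open>Both sheets are taken together with their boundary curves; closures and boundaries of
  domains are relative to the half-plane. The sheets share exactly their boundaries.\<close>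

definition bi_graph :: "(real^3) set \<Rightarrow> bool" where
  "bi_graph S \<longleftrightarrow> (\<exists>D1 D2 f1 f2.
     (\<forall>(D, f) \<in> {(D1, f1), (D2, f2)}.
        D \<subseteq> halfplane \<and> open D \<and> connected D \<and> D \<noteq> {} \<and>
        smooth_on D f \<and> continuous_on (closure D \<inter> halfplane) f) \<and>
     S = graph_over (closure D1 \<inter> halfplane) f1 \<union> graph_over (closure D2 \<inter> halfplane) f2 \<and>
     graph_over (closure D1 \<inter> halfplane) f1 \<inter> graph_over (closure D2 \<inter> halfplane) f2
       = graph_over (frontier D1 \<inter> halfplane) f1 \<and>
     graph_over (frontier D1 \<inter> halfplane) f1 = graph_over (frontier D2 \<inter> halfplane) f2 \<and>
     frontier D1 \<inter> halfplane \<noteq> {})"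

text \<open>\<open>S\<close> has an end which is a graph over a horodisk \<open>y > a\<close> and whose distance to the slice, which
  in the product metric is the height difference, tends to zero as \<open>y\<close> tends to infinity, uniformly
  in \<open>x\<close>. Divergence with \<open>y\<close> bounded (along an orbit of the parabolic translations) has to be
  excluded, because the height is constant on orbits.\<close>

definition asymptotic_to_slice :: "(real^3) set \<Rightarrow> real \<Rightarrow> bool" where
  "asymptotic_to_slice S z0 \<longleftrightarrow> (\<exists>a>0. \<exists>f. graph_over {w. w $ 2 > a} f \<subseteq> S \<and>
     (\<forall>\<epsilon>>0. \<exists>b. \<forall>w. w $ 2 > a \<and> w $ 2 > b \<longrightarrow> \<bar>f w - z0\<bar> < \<epsilon>))"

end

theory Submission
  imports Defs
begin

text \<open>
  The immersion \<open>(s, t) \<mapsto> (t, y s, z s)\<close> has orthogonal coordinate fields and a normal without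
  \<open>x\<close>-component, so the translator condition reduces to one ordinary differential equation for
  the profile. With \<open>w = ln y\<close> the \<open>yz\<close>-half-plane is the Euclidean \<open>wz\<close>-plane and the equation reads
  \<open>z' w'' - w' z'' = z' (w'\<^sup>2 + z'\<^sup>2)\<close>: it is the equation of the planar grim reaper, whose solutions
  are the geodesics of the metric \<open>exp (2 w) (dw\<^sup>2 + dz\<^sup>2)\<close>. The reduction, including the existence
  of a smooth unit normal, is \<open>parabolic_h_grim_reaper_iff\<close>.

  The Clairaut integral \<open>y z' / sqrt (w'\<^sup>2 + z'\<^sup>2)\<close> of vertical translation is constant along
  solutions (\<open>translator_first_integral\<close>). Hence \<open>z'\<close> vanishes everywhere, and the curve lies in a
  slice, or nowhere. In the second case \<open>p = w' / z'\<close> satisfies \<open>p' = z' (1 + p\<^sup>2)\<close>, so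
  \<open>arctan p - z\<close> is constant; integrating \<open>w' = z' tan (z - a)\<close> gives \<open>y cos (z - a) = const\<close>
  (\<open>translator_normal_form\<close>), and \<open>\<phi> = ln (tan ((z - a + pi/2) / 2))\<close> is a regular parameter
  that turns this into the model curve (\<open>translator_grim_parameter\<close>).

  So every solution is a piece of a model curve, and a maximal one must be all of it
  (\<open>maximal_covers\<close>). Conversely the models do not extend: an extension is again a solution, hence
  a piece of a model curve itself, and comparison of \<open>y\<close>, respectively of the range of \<open>z\<close>, leaves
  no room for further points (\<open>maximal_slice\<close>, \<open>maximal_grim\<close>).

  The global properties are read off the equation \<open>y sin (z - 2 c2) = 2 c1\<close>, with \<open>z - 2 c2\<close> in
  \<open>(0, pi)\<close>, of the grim surface: its two sheets are given by the two inverse branches of the sine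
  on that interval.
\<close>

section \<open>Calculus of smooth functions\<close>

lemma Ck_on_cong:
  assumes "open U" "Ck_on k U f" "\<And>x. x \<in> U \<Longrightarrow> f x = g x"
  shows "Ck_on k U g"
  using assms(2,3)
proof (induction k arbitrary: f g)
  case 0
  then show ?case using continuous_on_cong by force
next
  case (Suc k)
  have d: "(g has_derivative frechet_derivative f (at x)) (at x)" if "x \<in> U" for x
    using Suc.prems that assms(1)
    by (metis Ck_on.simps(2) frechet_derivative_works has_derivative_transform_within_open)
  have "Ck_on k U (\<lambda>x. frechet_derivative g (at x) v)" for v
    by (rule Suc.IH[of "\<lambda>x. frechet_derivative f (at x) v"])
      (use Suc.prems(1) frechet_derivative_at[OF d] in auto)
  then show ?case using d by (auto simp: differentiable_def)
qed

lemma Ck_on_Suc: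
  assumes "open U" "\<And>x. x \<in> U \<Longrightarrow> (f has_derivative f' x) (at x)"
    "\<And>v. Ck_on k U (\<lambda>x. f' x v)"
  shows "Ck_on (Suc k) U f"
proof -
  have "Ck_on k U (\<lambda>x. frechet_derivative f (at x) v)" for v
    by (rule Ck_on_cong[OF assms(1) assms(3)[of v]]) (metis assms(2) frechet_derivative_at)
  then show ?thesis using assms(2) by (auto simp: differentiable_def)
qed

lemma Ck_on_SucD:
  assumes "Ck_on (Suc k) U f"
  shows "x \<in> U \<Longrightarrow> (f has_derivative frechet_derivative f (at x)) (at x)"
    and "Ck_on k U (\<lambda>x. frechet_derivative f (at x) v)"
  using assms by (auto simp: frechet_derivative_works)

lemma Ck_on_lower: "Ck_on (Suc k) U f \<Longrightarrow> Ck_on k U f"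
proof (induction k arbitrary: f)
  case 0
  then show ?case
    by (auto intro!: continuous_at_imp_continuous_on differentiable_imp_continuous_within)
qed auto

lemma Ck_on_const: "open U \<Longrightarrow> Ck_on k U (\<lambda>x. c)"
proof (induction k arbitrary: c)
  case (Suc k)
  show ?case by (rule Ck_on_Suc[where f'="\<lambda>x v. 0"]) (use Suc in auto)
qed auto

lemma Ck_on_add:
  assumes "open U" "Ck_on k U f" "Ck_on k U g"
  shows "Ck_on k U (\<lambda>x. f x + g x)"
  using assms(2,3)
proof (induction k arbitrary: f g)
  case (Suc k)
  show ?case
    by (rule Ck_on_Suc[OF assms(1) has_derivative_add[OF Ck_on_SucD(1)[OF Suc.prems(1)] Ck_on_SucD(1)[OF Suc.prems(2)]]])
       (use Suc in auto)
qed (auto intro: continuous_on_add)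

text \<open>The product rule expresses a directional derivative of a product by products whose factors are \<open>C\<^sup>k\<close>,
  so the induction closes for all bilinear operations at once.\<close>

lemma (in bounded_bilinear) Ck_on:
  assumes "open U" "Ck_on k U f" "Ck_on k U g"
  shows "Ck_on k U (\<lambda>x. prod (f x) (g x))"
  using assms(2,3)
proof (induction k arbitrary: f g)
  case (Suc k)
  show ?case
  proof (rule Ck_on_Suc[OF assms(1) FDERIV[OF Ck_on_SucD(1)[OF Suc.prems(1)] Ck_on_SucD(1)[OF Suc.prems(2)]]])
    show "Ck_on k U (\<lambda>x. prod (f x) (frechet_derivative g (at x) v) + prod (frechet_derivative f (at x) v) (g x))" for v
      using Suc.prems by (intro Ck_on_add Suc.IH assms) (auto intro: Ck_on_lower simp del: Ck_on.simps dest: Ck_on_SucD(2))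
  qed
qed (auto intro: continuous_on)

lemma Ck_on_linear_comp:
  assumes "bounded_linear L" "open U" "Ck_on k U f"
  shows "Ck_on k U (\<lambda>x. L (f x))"
  using assms(3)
proof (induction k arbitrary: f)
  case (Suc k)
  show ?case
    by (rule Ck_on_Suc[OF assms(2) bounded_linear.has_derivative[OF assms(1) Ck_on_SucD(1)[OF Suc.prems]]])
       (use Suc in auto)
qed (auto intro: bounded_linear.continuous_on[OF assms(1)])

text \<open>With this lemma smoothness of a function of one coordinate is transferred between an interval and
  a region of the plane, in both directions, without a general chain rule.\<close>

lemma Ck_on_comp_linear:
  assumes "bounded_linear L" "open V" "L ` V \<subseteq> U" "Ck_on k U f"
  shows "Ck_on k V (\<lambda>x. f (L x))"
  using assms(4)
proof (induction k arbitrary: f)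
  case 0
  then show ?case
    using continuous_on_compose2[OF _ linear_continuous_on[OF assms(1)] assms(3)] by simp
next
  case (Suc k)
  show ?case
  proof (rule Ck_on_Suc[OF assms(2)])
    show "((\<lambda>x. f (L x)) has_derivative (\<lambda>v. frechet_derivative f (at (L x)) (L v))) (at x)" if "x \<in> V" for x
      using that assms(3)
      by (intro has_derivative_compose[OF bounded_linear_imp_has_derivative[OF assms(1)]]
          Ck_on_SucD(1)[OF Suc.prems]) auto
    show "Ck_on k V (\<lambda>x. frechet_derivative f (at (L x)) (L v))" for v
      using Suc by auto
  qed
qed

lemma Ck_on_DERIV:
  fixes f :: "real \<Rightarrow> real"
  assumes "open U" "\<And>x. x \<in> U \<Longrightarrow> (f has_real_derivative f' x) (at x)" "Ck_on k U f'"
  shows "Ck_on (Suc k) U f"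
  by (rule Ck_on_Suc[OF assms(1) assms(2)[unfolded has_field_derivative_def]])
     (use assms in \<open>auto intro!: bounded_bilinear.Ck_on[OF bounded_bilinear_mult] Ck_on_const\<close>)

lemma Ck_on_SucD_DERIV:
  fixes f :: "real \<Rightarrow> real"
  assumes "Ck_on (Suc k) U f" "open U"
  shows "x \<in> U \<Longrightarrow> (f has_real_derivative deriv f x) (at x)" and "Ck_on k U (deriv f)"
proof -
  show d: "(f has_real_derivative deriv f x) (at x)" if "x \<in> U" for x
    using assms that by (auto simp: DERIV_deriv_iff_real_differentiable)
  show "Ck_on k U (deriv f)"
    using Ck_on_SucD(2)[OF assms(1), of 1]
    by (rule Ck_on_cong[OF assms(2)])
      (metis d frechet_derivative_at has_field_derivative_imp_has_derivative mult.right_neutral)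
qed

lemma smooth_on_const: "open U \<Longrightarrow> smooth_on U (\<lambda>x. c)"
  and smooth_on_add: "open U \<Longrightarrow> smooth_on U f \<Longrightarrow> smooth_on U g \<Longrightarrow> smooth_on U (\<lambda>x. f x + g x)"
  and smooth_on_cong: "open U \<Longrightarrow> smooth_on U f \<Longrightarrow> (\<And>x. x \<in> U \<Longrightarrow> f x = h x) \<Longrightarrow> smooth_on U h"
  by (auto simp: smooth_on_def intro: Ck_on_const Ck_on_add Ck_on_cong)

lemma smooth_on_mult:
  fixes f g :: "_ \<Rightarrow> real"
  shows "open U \<Longrightarrow> smooth_on U f \<Longrightarrow> smooth_on U g \<Longrightarrow> smooth_on U (\<lambda>x. f x * g x)"
  by (auto simp: smooth_on_def intro: bounded_bilinear.Ck_on[OF bounded_bilinear_mult])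

lemma smooth_on_linear_comp:
  "bounded_linear L \<Longrightarrow> open U \<Longrightarrow> smooth_on U f \<Longrightarrow> smooth_on U (\<lambda>x. L (f x))"
  by (auto simp: smooth_on_def intro: Ck_on_linear_comp)

lemma smooth_on_comp_linear:
  "bounded_linear L \<Longrightarrow> open V \<Longrightarrow> L ` V \<subseteq> U \<Longrightarrow> smooth_on U f \<Longrightarrow> smooth_on V (\<lambda>x. f (L x))"
  by (auto simp: smooth_on_def intro: Ck_on_comp_linear)

lemma smooth_on_DERIV:
  fixes f :: "real \<Rightarrow> real"
  assumes "open U" "\<And>x. x \<in> U \<Longrightarrow> (f has_real_derivative f' x) (at x)" "smooth_on U f'"
  shows "smooth_on U f"
  using Ck_on_DERIV[OF assms(1,2)] assms(3) unfolding smooth_on_def by (meson Ck_on_lower)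

lemma smooth_on_ident: "open U \<Longrightarrow> smooth_on U (\<lambda>x::real. x)"
  by (rule smooth_on_DERIV[where f'="\<lambda>_. 1"]) (auto intro: smooth_on_const)

lemma smooth_onD:
  fixes f :: "real \<Rightarrow> real"
  assumes "smooth_on U f" "open U"
  shows "x \<in> U \<Longrightarrow> (f has_real_derivative deriv f x) (at x)" and "smooth_on U (deriv f)"
proof -
  show "x \<in> U \<Longrightarrow> (f has_real_derivative deriv f x) (at x)"
    using Ck_on_SucD_DERIV(1)[of 0 U f x] assms by (simp add: smooth_on_def del: Ck_on.simps)
  show "smooth_on U (deriv f)"
    using Ck_on_SucD_DERIV(2)[of _ U f] assms by (simp add: smooth_on_def del: Ck_on.simps)
qed

text \<open>The function \<open>g = f powr (-1/2)\<close> solves \<open>g' = - f' g^3 / 2\<close>, whose right-hand side is polynomial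
  in \<open>g\<close> and \<open>f'\<close>; so each step of the induction raises the regularity of \<open>g\<close> by one. Reciprocals
  and the normalization of the unit normal come from this case.\<close>

lemma smooth_on_inverse_sqrt:
  fixes f :: "real \<Rightarrow> real"
  assumes "open U" "smooth_on U f" "\<And>x. x \<in> U \<Longrightarrow> f x > 0"
  shows "smooth_on U (\<lambda>x. inverse (sqrt (f x)))"
proof -
  let ?g = "\<lambda>x. inverse (sqrt (f x))"
  have d: "(?g has_real_derivative (- 1/2) * (deriv f x * (?g x * (?g x * ?g x)))) (at x)" if "x \<in> U" for x
    using assms(3)[OF that]
    by (auto intro!: derivative_eq_intros smooth_onD(1)[OF assms(2,1) that] simp: field_simps)
  have "Ck_on k U ?g" for k
  proof (induction k)
    case 0
    have "continuous_on U f"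
      using assms(2) Ck_on.simps(1) unfolding smooth_on_def by blast
    then show ?case using assms(3)
      by (force intro!: continuous_intros)
  next
    case (Suc k)
    have "Ck_on k U (deriv f)" using smooth_onD(2)[OF assms(2,1)] by (simp add: smooth_on_def)
    then show ?case
      by (intro Ck_on_DERIV[OF assms(1) d] bounded_bilinear.Ck_on[OF bounded_bilinear_mult]
          assms(1) Ck_on_const Suc)
  qed
  then show ?thesis by (simp add: smooth_on_def)
qed

lemma smooth_on_inverse:
  fixes f :: "real \<Rightarrow> real"
  assumes "open U" "smooth_on U f" "\<And>x. x \<in> U \<Longrightarrow> f x > 0"
  shows "smooth_on U (\<lambda>x. inverse (f x))"
  by (rule smooth_on_cong[OF assms(1) smooth_on_inverse_sqrt[OF assms(1)
          smooth_on_mult[OF assms(1,2,2)]]])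
     (use assms(3) in \<open>force simp: real_sqrt_mult\<close>)+

text \<open>Hyperbolic sine and cosine have to be treated together, since each is the derivative of the other.\<close>

lemma smooth_on_cosh:
  fixes f :: "real \<Rightarrow> real"
  assumes "open U" "smooth_on U f"
  shows "smooth_on U (\<lambda>x. cosh (f x))"
proof -
  have "Ck_on k U (\<lambda>x. cosh (f x)) \<and> Ck_on k U (\<lambda>x. sinh (f x))" for k
  proof (induction k)
    case 0
    have "continuous_on U f"
      using assms(2) Ck_on.simps(1) unfolding smooth_on_def by blast
    then show ?case by (auto intro!: continuous_intros)
  next
    case (Suc k)
    have "Ck_on k U (\<lambda>x. sinh (f x) * deriv f x)" "Ck_on k U (\<lambda>x. cosh (f x) * deriv f x)"
      using Suc smooth_onD(2)[OF assms(2,1)]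
      by (auto simp: smooth_on_def intro!: bounded_bilinear.Ck_on[OF bounded_bilinear_mult] assms(1))
    then show ?case
      by (auto intro!: Ck_on_DERIV[OF assms(1)] derivative_eq_intros smooth_onD(1)[OF assms(2,1)] simp del: Ck_on.simps)
  qed
  then show ?thesis by (simp add: smooth_on_def)
qed

section \<open>The translator equation of a parabolic surface\<close>

lemma pd_at: "(f has_derivative f') (at x) \<Longrightarrow> pd i f x = f' (axis i 1)"
  unfolding pd_def by (metis frechet_derivative_at)

lemma has_derivative_nth: "((\<lambda>u::real^'n. u $ i) has_derivative (\<lambda>v. v $ i)) (at u)"
  by (rule bounded_linear_imp_has_derivative) (rule bounded_linear_vec_nth)

lemma pd_gmat:
  fixes p :: "real^3"
  assumes "p $ 2 > 0"
  shows "pd i (\<lambda>q. gmat q $ j $ l) p = (if j = l \<and> j \<noteq> 3 \<and> i = 2 then - 2 / (p $ 2)^3 else 0)"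
proof (cases "j = l \<and> j \<noteq> 3")
  case True
  then have e: "(\<lambda>q. gmat q $ j $ l) = (\<lambda>q. 1 / (q $ 2)\<^sup>2)" by (auto simp: gmat_def)
  have "((\<lambda>q::real^3. 1 / (q $ 2)\<^sup>2) has_derivative (\<lambda>v. - 2 * v $ 2 / (p $ 2)^3)) (at p)"
    using assms
    by (auto intro!: derivative_eq_intros has_derivative_nth simp: fun_eq_iff field_simps power2_eq_square power3_eq_cube)
  then show ?thesis using True unfolding e by (auto simp: pd_at axis_def)
next
  case False
  then have e: "(\<lambda>q. gmat q $ j $ l) = (\<lambda>q. gmat p $ j $ l)" by (auto simp: gmat_def)
  show ?thesis unfolding e using False by (auto simp: pd_at[OF has_derivative_const])
qed

lemma matrix_inv_diagonal:
  fixes A :: "real^'n^'n"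
  assumes "\<And>i j. i \<noteq> j \<Longrightarrow> A $ i $ j = 0" "\<And>i. A $ i $ i \<noteq> 0"
  shows "matrix_inv A = (\<chi> i j. if i = j then inverse (A $ i $ i) else 0)"
proof -
  define B :: "real^'n^'n" where "B = (\<chi> i j. if i = j then inverse (A $ i $ i) else 0)"
  have "(\<Sum>k\<in>UNIV. A $ i $ k * B $ k $ j) = (\<Sum>k\<in>UNIV. if k = i then A $ i $ i * B $ i $ j else 0)"
    for i j using assms(1) by (intro sum.cong) auto
  then have "A ** B = mat 1"
    using assms(2) by (simp add: matrix_matrix_mult_def mat_def vec_eq_iff) (simp add: B_def)
  then have AB: "A ** B = mat 1 \<and> B ** A = mat 1"
    by (simp add: matrix_left_right_inverse)
  then have "A ** matrix_inv A = mat 1 \<and> matrix_inv A ** A = mat 1"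
    unfolding matrix_inv_def by (rule someI)
  with AB have "matrix_inv A = B"
    by (metis matrix_mul_assoc matrix_mul_lid matrix_mul_rid)
  then show ?thesis by (simp add: B_def)
qed

lemma metric_eq: "metric p v w = (v$1 * w$1 + v$2 * w$2) / (p$2)\<^sup>2 + v$3 * w$3"
  by (simp add: metric_def gmat_def sum_3 add_divide_distrib)

text \<open>The nonzero symbols are those of the hyperbolic plane:
  \<open>\<Gamma>\<^sup>1\<^sub>1\<^sub>2 = \<Gamma>\<^sup>1\<^sub>2\<^sub>1 = \<Gamma>\<^sup>2\<^sub>2\<^sub>2 = - 1/y\<close> and \<open>\<Gamma>\<^sup>2\<^sub>1\<^sub>1 = 1/y\<close>.\<close>

lemma christoffel_sum:
  assumes "p $ 2 > 0"
  shows "(\<chi> k. \<Sum>a\<in>UNIV. \<Sum>b\<in>UNIV. christoffel k a b p * v $ a * w $ b) =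
    vector [- (v$1 * w$2 + v$2 * w$1) / p$2, (v$1 * w$1 - v$2 * w$2) / p$2, 0]"
proof -
  have i: "matrix_inv (gmat p) = (\<chi> i j. if i = j then inverse (gmat p $ i $ i) else 0)"
    by (rule matrix_inv_diagonal) (use assms in \<open>auto simp: gmat_def\<close>)
  show ?thesis
    using assms unfolding christoffel_def i
    by (simp add: vec_eq_iff forall_3 sum_3 pd_gmat)
       (simp add: gmat_def field_simps power2_eq_square power3_eq_cube)
qed


lemma trace_matrix_inv_diagonal_2:
  fixes A B :: "real^2^2"
  assumes "A $ 1 $ 2 = 0" "A $ 2 $ 1 = 0" "A $ 1 $ 1 \<noteq> 0" "A $ 2 $ 2 \<noteq> 0"
  shows "trace (matrix_inv A ** B) = B $ 1 $ 1 / A $ 1 $ 1 + B $ 2 $ 2 / A $ 2 $ 2"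
proof -
  have i: "matrix_inv A = (\<chi> i j. if i = j then inverse (A $ i $ i) else 0)"
  proof (rule matrix_inv_diagonal)
    show "A $ i $ j = 0" if "i \<noteq> j" for i j
      using that assms exhaust_2[of i] exhaust_2[of j] by auto
    show "A $ i $ i \<noteq> 0" for i
      using assms exhaust_2[of i] by auto
  qed
  show ?thesis
    unfolding i by (simp add: trace_def matrix_matrix_mult_def sum_2 field_simps)
qed

lemma vector_3_axis:
  "(vector [a, b, c] :: real^3) = a *\<^sub>R axis 1 1 + b *\<^sub>R axis 2 1 + c *\<^sub>R axis 3 1"
  by (simp add: vec_eq_iff forall_3 vector_3 axis_def)

lemma open_strip: "open I \<Longrightarrow> open (strip I)"
  unfolding strip_def by (intro open_vimage[unfolded vimage_def] continuous_intros)

lemma ball_strip: "(\<forall>u\<in>strip I. P (u $ 1)) \<longleftrightarrow> (\<forall>s\<in>I. P s)"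
  unfolding strip_def by (metis (no_types, lifting) mem_Collect_eq vector_2(1))

lemma has_derivative_Psi:
  assumes "((\<lambda>s. fst (\<alpha> s)) has_real_derivative y') (at (u $ 1))"
    "((\<lambda>s. snd (\<alpha> s)) has_real_derivative z') (at (u $ 1))"
  shows "(Psi \<alpha> has_derivative (\<lambda>v. vector [v $ 2, y' * v $ 1, z' * v $ 1])) (at u)"
proof -
  note d = has_derivative_compose[OF has_derivative_nth assms(1)[unfolded has_field_derivative_def]]
    has_derivative_compose[OF has_derivative_nth assms(2)[unfolded has_field_derivative_def]]
  show ?thesis
    unfolding Psi_def vector_3_axis
    by (intro has_derivative_add has_derivative_scaleR_left has_derivative_const has_derivative_nth d)
qed

lemma has_derivative_vector_3:
  assumes "(b has_real_derivative b') (at (u $ 1))" "(c has_real_derivative c') (at (u $ 1))"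
  shows "((\<lambda>u::real^2. vector [a, b (u $ 1), c (u $ 1)] :: real^3)
    has_derivative (\<lambda>v. vector [0, b' * v $ 1, c' * v $ 1])) (at u)"
proof -
  note d = has_derivative_compose[OF has_derivative_nth assms(1)[unfolded has_field_derivative_def]]
    has_derivative_compose[OF has_derivative_nth assms(2)[unfolded has_field_derivative_def]]
  show ?thesis
    unfolding vector_3_axis
    by (intro has_derivative_add has_derivative_scaleR_left has_derivative_const has_derivative_nth d)
qed

lemma smooth_on_Psi_iff:
  assumes "open I"
  shows "smooth_on (strip I) (Psi \<alpha>) \<longleftrightarrow> smooth_on I (\<lambda>s. fst (\<alpha> s)) \<and> smooth_on I (\<lambda>s. snd (\<alpha> s))"
proof
  assume *: "smooth_on (strip I) (Psi \<alpha>)"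
  have "smooth_on I (\<lambda>s. Psi \<alpha> (s *\<^sub>R axis 1 1))"
    by (rule smooth_on_comp_linear[OF _ assms _ *])
      (auto simp: strip_def axis_def intro: bounded_linear_scaleR_left)
  then have "smooth_on I (\<lambda>s. Psi \<alpha> (s *\<^sub>R axis 1 1) $ i)" for i
    by (rule smooth_on_linear_comp[OF bounded_linear_vec_nth assms])
  from this[of 2] this[of 3] show "smooth_on I (\<lambda>s. fst (\<alpha> s)) \<and> smooth_on I (\<lambda>s. snd (\<alpha> s))"
    by (simp add: Psi_def vector_3 axis_def)
next
  assume *: "smooth_on I (\<lambda>s. fst (\<alpha> s)) \<and> smooth_on I (\<lambda>s. snd (\<alpha> s))"
  note o = open_strip[OF assms]
  have "smooth_on (strip I) (\<lambda>u. u $ 2)"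
    by (rule smooth_on_comp_linear[OF _ o _ smooth_on_ident[OF open_UNIV]])
       (auto intro: bounded_linear_vec_nth)
  moreover have "smooth_on (strip I) (\<lambda>u. fst (\<alpha> (u $ 1)))" "smooth_on (strip I) (\<lambda>u. snd (\<alpha> (u $ 1)))"
    by (rule smooth_on_comp_linear[OF _ o, where U=I];
        use * in \<open>auto intro: bounded_linear_vec_nth simp: strip_def\<close>)+
  ultimately show "smooth_on (strip I) (Psi \<alpha>)"
    unfolding Psi_def[abs_def] vector_3_axis
    by (intro smooth_on_add o smooth_on_linear_comp[OF bounded_linear_scaleR_left o])
qed

lemma smooth_on_strip_vector:
  assumes "open I" "smooth_on I b" "smooth_on I c"
  shows "smooth_on (strip I) (\<lambda>u. vector [0, b (u $ 1), c (u $ 1)] :: real^3)"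
proof -
  note o = open_strip[OF assms(1)]
  have "smooth_on (strip I) (\<lambda>u. b (u $ 1))" "smooth_on (strip I) (\<lambda>u. c (u $ 1))"
    by (rule smooth_on_comp_linear[OF _ o, where U=I];
        use assms in \<open>auto intro: bounded_linear_vec_nth simp: strip_def\<close>)+
  then show ?thesis
    unfolding vector_3_axis
    by (intro smooth_on_add o smooth_on_linear_comp[OF bounded_linear_scaleR_left o] smooth_on_const)
qed

text \<open>The arguments are \<open>y\<close> and the first and second derivatives of \<open>y\<close> and \<open>z\<close> at one parameter value.
  Divided by \<open>y\<close>, this is \<open>z' w'' - w' z'' = (w'\<^sup>2 + z'\<^sup>2) z'\<close> for \<open>w = ln y\<close>.\<close>

definition translator_ode :: "real \<Rightarrow> real \<Rightarrow> real \<Rightarrow> real \<Rightarrow> real \<Rightarrow> bool" where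
  "translator_ode y y1 z1 y2 z2 \<longleftrightarrow>
     z1 * (y2 - y1\<^sup>2 / y) - y1 * z2 = (y1\<^sup>2 / y\<^sup>2 + z1\<^sup>2) * y * z1"

lemma pd_Psi:
  assumes "((\<lambda>s. fst (\<alpha> s)) has_real_derivative y') (at (u $ 1))"
    "((\<lambda>s. snd (\<alpha> s)) has_real_derivative z') (at (u $ 1))"
  shows "pd 1 (Psi \<alpha>) u = vector [0, y', z']" "pd 2 (Psi \<alpha>) u = vector [1, 0, 0]"
  using pd_at[OF has_derivative_Psi[OF assms]] by (simp_all add: axis_def)

text \<open>The first fundamental form is diagonal, so only the diagonal of the second one matters. The last
  summand comes from the curvature of the horocycles, along which \<open>\<nabla>\<^sub>t \<partial>\<^sub>t = (1/y) \<partial>\<^sub>y\<close>.\<close>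

lemma mean_curvature_Psi:
  fixes \<alpha> :: "real \<Rightarrow> real \<times> real"
  defines "y \<equiv> \<lambda>s. fst (\<alpha> s)" and "z \<equiv> \<lambda>s. snd (\<alpha> s)"
  assumes I: "open I" "u \<in> strip I"
    and dy: "\<And>s. s \<in> I \<Longrightarrow> (y has_real_derivative y' s) (at s)"
    and dz: "\<And>s. s \<in> I \<Longrightarrow> (z has_real_derivative z' s) (at s)"
    and dy': "(y' has_real_derivative y'') (at (u $ 1))"
    and dz': "(z' has_real_derivative z'') (at (u $ 1))"
    and pos: "y (u $ 1) > 0" and reg: "y' (u $ 1) \<noteq> 0 \<or> z' (u $ 1) \<noteq> 0"
    and N: "N u = vector [n1, n2, n3]"
  shows "mean_curvature (Psi \<alpha>) N u =
    ((n2 * (y'' - (y' (u $ 1))\<^sup>2 / y (u $ 1)) / (y (u $ 1))\<^sup>2 + n3 * z'')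
      / ((y' (u $ 1))\<^sup>2 / (y (u $ 1))\<^sup>2 + (z' (u $ 1))\<^sup>2) + n2 / y (u $ 1)) / 2"
proof -
  have s: "u $ 1 \<in> I" using I by (simp add: strip_def)
  let ?E = "(y' (u $ 1))\<^sup>2 / (y (u $ 1))\<^sup>2 + (z' (u $ 1))\<^sup>2"
  have E: "?E > 0"
    using reg pos by (auto intro: add_pos_nonneg add_nonneg_pos)
  have p1: "pd 1 (Psi \<alpha>) w = vector [0, y' (w $ 1), z' (w $ 1)]"
    and p2: "pd 2 (Psi \<alpha>) w = vector [1, 0, 0]" if "w \<in> strip I" for w
    using pd_Psi[OF dy[unfolded y_def] dz[unfolded z_def]] that by (auto simp: strip_def)
  have "(pd 1 (Psi \<alpha>) has_derivative (\<lambda>v. vector [0, y'' * v $ 1, z'' * v $ 1])) (at u)"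
    by (rule has_derivative_transform_within_open[OF has_derivative_vector_3[OF dy' dz'] open_strip])
       (use I p1 in auto)
  then have p11: "pd 1 (pd 1 (Psi \<alpha>)) u = vector [0, y'', z'']"
    by (simp add: pd_at axis_def)
  have "(pd 2 (Psi \<alpha>) has_derivative (\<lambda>v. 0)) (at u)"
    by (rule has_derivative_transform_within_open[OF has_derivative_const open_strip])
       (use I p2 in auto)
  then have p22: "pd 2 (pd 2 (Psi \<alpha>)) u = 0"
    by (simp add: pd_at)
  have X: "Psi \<alpha> u = vector [u $ 2, y (u $ 1), z (u $ 1)]"
    by (simp add: Psi_def y_def z_def)
  have ff: "first_form (Psi \<alpha>) u $ 1 $ 1 = ?E" "first_form (Psi \<alpha>) u $ 2 $ 2 = 1 / (y (u $ 1))\<^sup>2"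
    "first_form (Psi \<alpha>) u $ 1 $ 2 = 0" "first_form (Psi \<alpha>) u $ 2 $ 1 = 0"
    using I by (simp_all add: first_form_def p1 p2 metric_eq X vector_3 power2_eq_square)
  have c: "cov_deriv (Psi \<alpha>) i j u = pd i (pd j (Psi \<alpha>)) u +
    vector [- (pd i (Psi \<alpha>) u$1 * pd j (Psi \<alpha>) u$2 + pd i (Psi \<alpha>) u$2 * pd j (Psi \<alpha>) u$1) / y (u $ 1),
     (pd i (Psi \<alpha>) u$1 * pd j (Psi \<alpha>) u$1 - pd i (Psi \<alpha>) u$2 * pd j (Psi \<alpha>) u$2) / y (u $ 1), 0]" for i j
    unfolding cov_deriv_def using christoffel_sum[of "Psi \<alpha> u"] pos by (simp add: X vector_3)
  have sf: "second_form (Psi \<alpha>) N u $ 1 $ 1 = n2 * (y'' - (y' (u $ 1))\<^sup>2 / y (u $ 1)) / (y (u $ 1))\<^sup>2 + n3 * z''"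
    "second_form (Psi \<alpha>) N u $ 2 $ 2 = n2 / (y (u $ 1))^3"
    using I pos by (simp_all add: second_form_def c p11 p22 p1 p2 metric_eq X vector_3 N
      power2_eq_square power3_eq_cube)
  have t: "trace (matrix_inv (first_form (Psi \<alpha>) u) ** second_form (Psi \<alpha>) N u) =
    second_form (Psi \<alpha>) N u $ 1 $ 1 / ?E + second_form (Psi \<alpha>) N u $ 2 $ 2 / (1 / (y (u $ 1))\<^sup>2)"
    using trace_matrix_inv_diagonal_2[OF ff(3,4)] E pos unfolding ff by simp
  show ?thesis
    unfolding mean_curvature_def t sf using pos by (simp add: power3_eq_cube power2_eq_square)
qed

text \<open>The orthogonality relations force the normal to be a nonzero multiple of \<open>(0, y\<^sup>2 z', - y')\<close>. Both
  sides of the translator equation are linear in the normal, so that factor, and with it the choice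
  of orientation, cancels.\<close>

lemma translator_equation_iff:
  fixes \<alpha> :: "real \<Rightarrow> real \<times> real"
  defines "y \<equiv> \<lambda>s. fst (\<alpha> s)" and "z \<equiv> \<lambda>s. snd (\<alpha> s)"
  assumes I: "open I" "u \<in> strip I"
    and dy: "\<And>s. s \<in> I \<Longrightarrow> (y has_real_derivative y' s) (at s)"
    and dz: "\<And>s. s \<in> I \<Longrightarrow> (z has_real_derivative z' s) (at s)"
    and dy': "(y' has_real_derivative y'') (at (u $ 1))"
    and dz': "(z' has_real_derivative z'') (at (u $ 1))"
    and pos: "y (u $ 1) > 0" and reg: "y' (u $ 1) \<noteq> 0 \<or> z' (u $ 1) \<noteq> 0"
    and unit: "metric (Psi \<alpha> u) (N u) (N u) = 1"
    and orth: "\<And>i. metric (Psi \<alpha> u) (N u) (pd i (Psi \<alpha>) u) = 0"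
  shows "mean_curvature (Psi \<alpha>) N u = metric (Psi \<alpha> u) (N u) (dilation_field (Psi \<alpha> u)) \<longleftrightarrow>
    translator_ode (y (u $ 1)) (y' (u $ 1)) (z' (u $ 1)) y'' z''"
proof -
  define Y Y' Z' where "Y = y (u $ 1)" and "Y' = y' (u $ 1)" and "Z' = z' (u $ 1)"
  define E where "E = Y'\<^sup>2 / Y\<^sup>2 + Z'\<^sup>2"
  have s: "u $ 1 \<in> I" using I by (simp add: strip_def)
  have Y: "Y > 0" using pos by (simp add: Y_def)
  have E: "E > 0"
    using reg pos by (auto simp: E_def Y_def Y'_def Z'_def intro: add_pos_nonneg add_nonneg_pos)
  have X: "Psi \<alpha> u = vector [u $ 2, Y, z (u $ 1)]"
    by (simp add: Psi_def y_def z_def Y_def)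
  note p = pd_Psi[OF dy[OF s, unfolded y_def] dz[OF s, unfolded z_def], folded Y'_def Z'_def]
  have n1: "N u $ 1 = 0"
    using orth[of 2] Y by (simp add: p metric_eq X vector_3)
  have o: "N u $ 2 * Y' / Y\<^sup>2 + N u $ 3 * Z' = 0"
    using orth[of 1] by (simp add: p metric_eq X vector_3)
  have un: "(N u $ 2)\<^sup>2 / Y\<^sup>2 + (N u $ 3)\<^sup>2 = 1"
    using unit n1 by (simp add: metric_eq X vector_3 power2_eq_square)
  \<comment> \<open>The metric pairing of the normal with \<open>(0, y\<^sup>2 z', - y')\<close>, divided by the squared metric length
    of that vector.\<close>
  define l where "l = (N u $ 2 * Z' - N u $ 3 * Y') / (Y\<^sup>2 * E)"
  have n2: "N u $ 2 = l * (Y\<^sup>2 * Z')" and n3: "N u $ 3 = - l * Y'"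
  proof -
    have D: "Y\<^sup>2 * E = Y'\<^sup>2 + Y\<^sup>2 * Z'\<^sup>2"
      using Y by (simp add: E_def field_simps)
    have D0: "Y\<^sup>2 * E > 0" using Y E by simp
    have o': "N u $ 2 * Y' = - (Y\<^sup>2 * (N u $ 3 * Z'))"
      using o Y by (simp add: field_simps)
    have "N u $ 2 * (Y\<^sup>2 * E) = (N u $ 2 * Z' - N u $ 3 * Y') * (Y\<^sup>2 * Z')"
      unfolding D using o' by algebra
    then show "N u $ 2 = l * (Y\<^sup>2 * Z')"
      using D0 unfolding l_def by (metis less_irrefl nonzero_eq_divide_eq times_divide_eq_left minus_divide_left)
    have "N u $ 3 * (Y\<^sup>2 * E) = - (N u $ 2 * Z' - N u $ 3 * Y') * Y'"
      unfolding D using o' by algebra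
    then show "N u $ 3 = - l * Y'"
      using D0 unfolding l_def by (metis less_irrefl nonzero_eq_divide_eq times_divide_eq_left minus_divide_left)
  qed
  have l: "l \<noteq> 0" using un by (auto simp: n2 n3)
  have N: "N u = vector [0, l * (Y\<^sup>2 * Z'), - l * Y']"
    using n1 n2 n3 by (simp add: vec_eq_iff forall_3 vector_3)
  have "mean_curvature (Psi \<alpha>) N u =
     ((l * (Y\<^sup>2 * Z') * (y'' - Y'\<^sup>2 / Y) / Y\<^sup>2 + - l * Y' * z'') / E + l * (Y\<^sup>2 * Z') / Y) / 2"
    using mean_curvature_Psi[where \<alpha>=\<alpha> and I=I and u=u and y'=y' and z'=z' and N=N,
        OF I dy[unfolded y_def] dz[unfolded z_def] dy' dz' pos[unfolded y_def] reg N]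
    unfolding Y_def[symmetric, unfolded y_def] Y'_def[symmetric] Z'_def[symmetric] E_def[symmetric] .
  also have "\<dots> = (l * (Z' * (y'' - Y'\<^sup>2 / Y) - Y' * z'') / E + l * (Y * Z')) / 2"
    using Y E by (simp add: field_simps power2_eq_square)
  finally have "mean_curvature (Psi \<alpha>) N u =
     (l * (Z' * (y'' - Y'\<^sup>2 / Y) - Y' * z'') / E + l * (Y * Z')) / 2" .
  moreover have "metric (Psi \<alpha> u) (N u) (dilation_field (Psi \<alpha> u)) = l * (Y * Z')"
    using Y by (simp add: N X metric_eq vector_3 dilation_field_def power2_eq_square)
  moreover have half: "(a + b) / 2 = b \<longleftrightarrow> a = b" for a b :: real by auto
  ultimately have "mean_curvature (Psi \<alpha>) N u = metric (Psi \<alpha> u) (N u) (dilation_field (Psi \<alpha> u)) \<longleftrightarrow>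
     l * (Z' * (y'' - Y'\<^sup>2 / Y) - Y' * z'') / E = l * (Y * Z')" by (simp only: half)
  also have "\<dots> \<longleftrightarrow> l * (Z' * (y'' - Y'\<^sup>2 / Y) - Y' * z'') = l * (E * Y * Z')"
    using E by (subst nonzero_divide_eq_eq) (auto simp: mult.commute mult.left_commute)
  also have "\<dots> \<longleftrightarrow> translator_ode Y Y' Z' y'' z''"
    using l unfolding mult_cancel_left translator_ode_def E_def by simp
  finally show ?thesis by (simp add: Y_def Y'_def Z'_def)
qed


definition translator_profile :: "real set \<Rightarrow> (real \<Rightarrow> real \<times> real) \<Rightarrow> bool" where
  "translator_profile I \<alpha> \<longleftrightarrow> (let y = (\<lambda>s. fst (\<alpha> s)); z = (\<lambda>s. snd (\<alpha> s)) in
     smooth_on I y \<and> smooth_on I z \<and>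
     (\<forall>s\<in>I. y s > 0 \<and> (deriv y s \<noteq> 0 \<or> deriv z s \<noteq> 0) \<and>
       translator_ode (y s) (deriv y s) (deriv z s) (deriv (deriv y) s) (deriv (deriv z) s)))"

lemma immersion_on_Psi_iff:
  fixes \<alpha> :: "real \<Rightarrow> real \<times> real"
  defines "y \<equiv> \<lambda>s. fst (\<alpha> s)" and "z \<equiv> \<lambda>s. snd (\<alpha> s)"
  assumes I: "open I"
  shows "immersion_on (strip I) (Psi \<alpha>) \<longleftrightarrow> smooth_on I y \<and> smooth_on I z \<and>
    (\<forall>s\<in>I. y s > 0 \<and> (deriv y s \<noteq> 0 \<or> deriv z s \<noteq> 0))"
proof (cases "smooth_on I y \<and> smooth_on I z")
  case True
  have f: "frechet_derivative (Psi \<alpha>) (at u) =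
      (\<lambda>v. vector [v $ 2, deriv y (u $ 1) * v $ 1, deriv z (u $ 1) * v $ 1])" if "u \<in> strip I" for u
    using has_derivative_Psi[of \<alpha> _ u, folded y_def z_def] smooth_onD(1)[of I _ "u $ 1"] True I that
    by (metis (no_types, lifting) frechet_derivative_at mem_Collect_eq strip_def)
  have inj: "inj (\<lambda>v::real^2. vector [v $ 2, a * v $ 1, b * v $ 1] :: real^3) \<longleftrightarrow> a \<noteq> 0 \<or> b \<noteq> 0" for a b
  proof
    assume i: "inj (\<lambda>v::real^2. vector [v $ 2, a * v $ 1, b * v $ 1] :: real^3)"
    show "a \<noteq> 0 \<or> b \<noteq> 0"
    proof (rule ccontr)
      assume "\<not> (a \<noteq> 0 \<or> b \<noteq> 0)"
      then have "axis 1 1 = (0 :: real^2)"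
        by (intro injD[OF i]) (simp add: axis_def)
      then show False by (simp add: axis_eq_0_iff)
    qed
  next
    assume "a \<noteq> 0 \<or> b \<noteq> 0"
    then show "inj (\<lambda>v::real^2. vector [v $ 2, a * v $ 1, b * v $ 1] :: real^3)"
      by (auto simp: inj_def vec_eq_iff forall_2 forall_3 vector_3)
  qed
  have "smooth_on (strip I) (Psi \<alpha>)"
    using True I by (simp add: smooth_on_Psi_iff y_def z_def)
  moreover have "Psi \<alpha> ` strip I \<subseteq> H2R \<longleftrightarrow> (\<forall>s\<in>I. y s > 0)"
    using ball_strip[where P="\<lambda>s. y s > 0"]
    by (simp add: image_subset_iff H2R_def Psi_def vector_3 y_def)
  moreover have "(\<forall>u\<in>strip I. inj (frechet_derivative (Psi \<alpha>) (at u)))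
      \<longleftrightarrow> (\<forall>s\<in>I. deriv y s \<noteq> 0 \<or> deriv z s \<noteq> 0)"
  proof -
    have "(\<forall>u\<in>strip I. inj (frechet_derivative (Psi \<alpha>) (at u))) \<longleftrightarrow>
       (\<forall>u\<in>strip I. deriv y (u $ 1) \<noteq> 0 \<or> deriv z (u $ 1) \<noteq> 0)"
      by (simp add: f inj)
    also have "\<dots> \<longleftrightarrow> (\<forall>s\<in>I. deriv y s \<noteq> 0 \<or> deriv z s \<noteq> 0)"
      by (rule ball_strip)
    finally show ?thesis .
  qed
  ultimately show ?thesis using True by (auto simp: immersion_on_def)
next
  case False
  then show ?thesis
    using I by (auto simp: immersion_on_def smooth_on_Psi_iff y_def z_def)
qed

text \<open>Since the translator equation does not depend on the choice of the unit normal, it only remains to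
  know that a smooth one exists: \<open>(0, y z', - w') / sqrt (w'\<^sup>2 + z'\<^sup>2)\<close> with \<open>w' = y'/y\<close>.\<close>

lemma unit_normal_Psi_exists:
  assumes I: "open I" and im: "immersion_on (strip I) (Psi \<alpha>)"
  shows "\<exists>N. unit_normal_on (strip I) (Psi \<alpha>) N"
proof -
  define y z where "y = (\<lambda>s. fst (\<alpha> s))" and "z = (\<lambda>s. snd (\<alpha> s))"
  have sm: "smooth_on I y" "smooth_on I z" and pos: "\<And>s. s \<in> I \<Longrightarrow> y s > 0"
    and reg: "\<And>s. s \<in> I \<Longrightarrow> deriv y s \<noteq> 0 \<or> deriv z s \<noteq> 0"
    using im unfolding immersion_on_Psi_iff[OF I] by (auto simp: y_def z_def)
  note sm' = smooth_onD(2)[OF sm(1) I] smooth_onD(2)[OF sm(2) I]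
  define w where "w = (\<lambda>s. deriv y s * inverse (y s))"
  define E where "E = (\<lambda>s. w s * w s + deriv z s * deriv z s)"
  have E: "E s > 0" if "s \<in> I" for s
    using reg[OF that] pos[OF that] unfolding E_def w_def
    by (metis add_nonneg_pos add_pos_nonneg inverse_nonzero_iff_nonzero less_irrefl
        mult_eq_0_iff not_square_less_zero linorder_not_less order_le_less)
  define g where "g = (\<lambda>s. inverse (sqrt (E s)))"
  have g: "g s * g s * E s = 1" if "s \<in> I" for s
    using E[OF that] by (simp add: g_def field_simps)
  have smw: "smooth_on I w"
    unfolding w_def by (intro smooth_on_mult I sm' sm smooth_on_inverse pos)
  have smg: "smooth_on I g"
    unfolding g_def by (intro smooth_on_inverse_sqrt E I)
      (auto simp: E_def intro!: smooth_on_add smooth_on_mult I sm' smw)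
  define N :: "real^2 \<Rightarrow> real^3"
    where "N = (\<lambda>u. vector [0, y (u $ 1) * (deriv z (u $ 1) * g (u $ 1)), (-1) * (w (u $ 1) * g (u $ 1))])"
  have "unit_normal_on (strip I) (Psi \<alpha>) N"
    unfolding unit_normal_on_def
  proof (intro conjI ballI)
    show "smooth_on (strip I) N"
      unfolding N_def by (intro smooth_on_strip_vector I smooth_on_mult sm sm' smg smw smooth_on_const)
    fix u assume "u \<in> strip I"
    then have s: "u $ 1 \<in> I" by (simp add: strip_def)
    have X: "Psi \<alpha> u = vector [u $ 2, y (u $ 1), z (u $ 1)]"
      by (simp add: Psi_def y_def z_def)
    have "metric (Psi \<alpha> u) (N u) (N u) = g (u $ 1) * g (u $ 1) * E (u $ 1)"
      using pos[OF s] by (simp add: X metric_eq vector_3 N_def E_def power2_eq_square field_simps)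
    then show "metric (Psi \<alpha> u) (N u) (N u) = 1" using g[OF s] by simp
    note p = pd_Psi[OF smooth_onD(1)[OF sm(1)[unfolded y_def] I s]
       smooth_onD(1)[OF sm(2)[unfolded z_def] I s], folded y_def z_def]
    show "\<forall>i. metric (Psi \<alpha> u) (N u) (pd i (Psi \<alpha>) u) = 0"
      using pos[OF s] unfolding forall_2
      by (simp add: X metric_eq vector_3 N_def p w_def power2_eq_square field_simps)
  qed
  then show ?thesis by blast
qed

text \<open>Immersion, normal and mean curvature are expressed through the profile alone, so the classification
  becomes a problem about plane curves.\<close>

lemma parabolic_h_grim_reaper_iff:
  "parabolic_h_grim_reaper I \<alpha> \<longleftrightarrow> open I \<and> is_interval I \<and> I \<noteq> {} \<and> translator_profile I \<alpha>"
proof (cases "open I")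
  case I: True
  define y z where "y = (\<lambda>s. fst (\<alpha> s))" and "z = (\<lambda>s. snd (\<alpha> s))"
  let ?ode = "\<lambda>s. translator_ode (y s) (deriv y s) (deriv z s) (deriv (deriv y) s) (deriv (deriv z) s)"
  have tr: "(\<forall>u\<in>strip I. mean_curvature (Psi \<alpha>) N u = metric (Psi \<alpha> u) (N u) (dilation_field (Psi \<alpha> u)))
     \<longleftrightarrow> (\<forall>s\<in>I. ?ode s)"
    if im: "immersion_on (strip I) (Psi \<alpha>)" and N: "unit_normal_on (strip I) (Psi \<alpha>) N" for N
  proof -
    have sm: "smooth_on I y" "smooth_on I z" and pos: "\<And>s. s \<in> I \<Longrightarrow> y s > 0"
      and reg: "\<And>s. s \<in> I \<Longrightarrow> deriv y s \<noteq> 0 \<or> deriv z s \<noteq> 0"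
      using im unfolding immersion_on_Psi_iff[OF I] by (auto simp: y_def z_def)
    have "mean_curvature (Psi \<alpha>) N u = metric (Psi \<alpha> u) (N u) (dilation_field (Psi \<alpha> u)) \<longleftrightarrow> ?ode (u $ 1)"
      if u: "u \<in> strip I" for u
    proof -
      have s: "u $ 1 \<in> I" using u by (simp add: strip_def)
      show ?thesis unfolding y_def z_def
        by (rule translator_equation_iff[OF I u])
          (use N s u pos reg smooth_onD[OF sm(1) I] smooth_onD[OF sm(2) I]
            smooth_onD(1)[OF smooth_onD(2)[OF sm(1) I] I] smooth_onD(1)[OF smooth_onD(2)[OF sm(2) I] I]
            in \<open>auto simp: unit_normal_on_def y_def z_def\<close>)
    qed
    then show ?thesis
      by (simp add: ball_strip[where P="?ode"])
  qed
  show ?thesis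
    using I tr unit_normal_Psi_exists[OF I, of \<alpha>] immersion_on_Psi_iff[OF I, of \<alpha>]
    unfolding parabolic_h_grim_reaper_def h_translator_def translator_profile_def Let_def
      y_def z_def by (auto simp: open_strip)
qed (auto simp: parabolic_h_grim_reaper_def)

section \<open>Solving the profile equation\<close>

lemma zero_derivative_const_on:
  fixes f :: "real \<Rightarrow> real"
  assumes "is_interval I" "\<And>s. s \<in> I \<Longrightarrow> (f has_real_derivative 0) (at s)" "s \<in> I" "t \<in> I"
  shows "f s = f t"
proof -
  have "\<exists>c. \<forall>x\<in>I. f x = c"
    by (rule has_field_derivative_zero_constant)
      (use assms in \<open>auto simp: is_interval_convex has_field_derivative_at_within\<close>)
  then show ?thesis using assms by auto
qed

lemma inj_on_nonzero_derivative:
  fixes f :: "real \<Rightarrow> real"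
  assumes "is_interval I" "\<And>s. s \<in> I \<Longrightarrow> (f has_real_derivative f' s) (at s)"
    "\<And>s. s \<in> I \<Longrightarrow> f' s \<noteq> 0"
  shows "inj_on f I"
proof -
  have ne: "f s \<noteq> f t" if st: "s \<in> I" "t \<in> I" "s < t" for s t
  proof
    assume "f s = f t"
    have sub: "{s..t} \<subseteq> I"
      using assms(1) st unfolding is_interval_1 by (meson atLeastAtMost_iff subsetI)
    obtain x where "s < x" "x < t" "f t - f s = (t - s) * f' x"
      using MVT2[OF st(3), of f f'] sub assms(2) by (meson atLeastAtMost_iff subsetD)
    moreover have "x \<in> I"
      using sub \<open>s < x\<close> \<open>x < t\<close> by (meson atLeastAtMost_iff less_imp_le subsetD)
    ultimately show False using assms(3) \<open>f s = f t\<close> st(3) by auto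
  qed
  show ?thesis by (rule linorder_inj_onI') (use ne in auto)
qed

lemma translator_odeD:
  assumes "translator_ode y y1 z1 y2 z2" "y > 0"
  shows "z1 * (y2 * y - y1\<^sup>2) - y1 * z2 * y = (y1\<^sup>2 + z1\<^sup>2 * y\<^sup>2) * z1"
proof -
  have "z1 * (y2 * y - y1\<^sup>2) - y1 * z2 * y = y * (z1 * (y2 - y1\<^sup>2 / y) - y1 * z2)"
    using assms(2) by (simp add: field_simps)
  also have "\<dots> = y * ((y1\<^sup>2 / y\<^sup>2 + z1\<^sup>2) * y * z1)"
    using assms(1) by (simp only: translator_ode_def)
  also have "\<dots> = (y1\<^sup>2 + z1\<^sup>2 * y\<^sup>2) * z1"
    using assms(2) by (simp add: field_simps power2_eq_square)
  finally show ?thesis .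
qed

text \<open>The square of the Clairaut integral, \<open>Q = y\<^sup>2 z'\<^sup>2 / (w'\<^sup>2 + z'\<^sup>2)\<close>, is constant and is zero
  exactly where \<open>z'\<close> is. This replaces the uniqueness theorem for the differential equation, which
  would first need a choice of parameter.\<close>

lemma translator_first_integral:
  fixes I \<alpha> defines "y \<equiv> \<lambda>s. fst (\<alpha> s)" and "z \<equiv> \<lambda>s. snd (\<alpha> s)"
  assumes I: "open I" "is_interval I" and t: "translator_profile I \<alpha>" and s: "s \<in> I" "r \<in> I"
    and z: "deriv z s = 0"
  shows "deriv z r = 0"
proof -
  have sm: "smooth_on I y" "smooth_on I z" and pos: "\<And>s. s \<in> I \<Longrightarrow> y s > 0"
    and reg: "\<And>s. s \<in> I \<Longrightarrow> deriv y s \<noteq> 0 \<or> deriv z s \<noteq> 0"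
    and ode: "\<And>s. s \<in> I \<Longrightarrow> translator_ode (y s) (deriv y s) (deriv z s) (deriv (deriv y) s) (deriv (deriv z) s)"
    using t by (auto simp: translator_profile_def y_def z_def Let_def)
  note d = smooth_onD(1)[OF sm(1) I(1)] smooth_onD(1)[OF sm(2) I(1)]
    smooth_onD(1)[OF smooth_onD(2)[OF sm(1) I(1)] I(1)] smooth_onD(1)[OF smooth_onD(2)[OF sm(2) I(1)] I(1)]
  define Q where "Q = (\<lambda>s. (y s)^4 * (deriv z s)^2 / ((deriv y s)^2 + (y s)^2 * (deriv z s)^2))"
  have E: "(deriv y s)^2 + (y s)^2 * (deriv z s)^2 > 0" if "s \<in> I" for s
    using reg[OF that] pos[OF that] by (auto intro: add_pos_nonneg add_nonneg_pos)
  have "(Q has_real_derivative 0) (at s)" if s: "s \<in> I" for s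
  proof -
    define a b a1 b1 a2 b2 where "a = y s" and "b = z s" and "a1 = deriv y s" and "b1 = deriv z s"
      and "a2 = deriv (deriv y) s" and "b2 = deriv (deriv z) s"
    note ab = a_def b_def a1_def b1_def a2_def b2_def
    have a: "a > 0" using pos s by (simp add: ab)
    have o: "b1 * (a2 * a - a1\<^sup>2) - a1 * b2 * a = (a1\<^sup>2 + b1\<^sup>2 * a\<^sup>2) * b1"
      using translator_odeD[OF ode[OF s] pos[OF s]] by (simp only: ab)
    have dN: "((\<lambda>s. (y s)^4 * (deriv z s)\<^sup>2) has_real_derivative
        4 * a^3 * a1 * b1\<^sup>2 + a^4 * (2 * b1 * b2)) (at s)"
      unfolding ab by (auto intro!: derivative_eq_intros d s)
    have dE: "((\<lambda>s. (deriv y s)\<^sup>2 + (y s)\<^sup>2 * (deriv z s)\<^sup>2) has_real_derivative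
        2 * a1 * a2 + (2 * a * a1 * b1\<^sup>2 + a\<^sup>2 * (2 * b1 * b2))) (at s)"
      unfolding ab by (auto intro!: derivative_eq_intros d s)
    \<comment> \<open>The numerator of the quotient rule is a multiple of the differential equation.\<close>
    have "((4 * a^3 * a1 * b1\<^sup>2 + a^4 * (2 * b1 * b2)) * (a1\<^sup>2 + a\<^sup>2 * b1\<^sup>2)
        - a^4 * b1\<^sup>2 * (2 * a1 * a2 + (2 * a * a1 * b1\<^sup>2 + a\<^sup>2 * (2 * b1 * b2))))
      = - 2 * a^3 * b1 * a1 * ((b1 * (a2 * a - a1\<^sup>2) - a1 * b2 * a) - (a1\<^sup>2 + b1\<^sup>2 * a\<^sup>2) * b1)"
      by algebra
    then show ?thesis
      using DERIV_divide[OF dN dE] E[OF s] o unfolding Q_def ab[symmetric] by simp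
  qed
  then have "Q s = Q r" using zero_derivative_const_on I s by metis
  then show ?thesis using z E[OF s(2)] pos[OF s(2)] by (auto simp: Q_def)
qed


text \<open>The slope \<open>p = w'/z'\<close> satisfies \<open>p' = z' (1 + p\<^sup>2)\<close>; hence \<open>arctan p = z - a\<close> for a constant \<open>a\<close>,
  and then \<open>(y cos (z - a))' = 0\<close>. The shift \<open>d = a - pi/2\<close> turns the cosine into the sine.\<close>

lemma translator_normal_form:
  fixes I \<alpha> defines "y \<equiv> \<lambda>s. fst (\<alpha> s)" and "z \<equiv> \<lambda>s. snd (\<alpha> s)"
  assumes I: "open I" "is_interval I" "I \<noteq> {}" and t: "translator_profile I \<alpha>"
    and z: "\<And>s. s \<in> I \<Longrightarrow> deriv z s \<noteq> 0"
  obtains C d where "C > 0" "\<And>s. s \<in> I \<Longrightarrow> 0 < z s - d \<and> z s - d < pi \<and> y s * sin (z s - d) = C"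
proof -
  have sm: "smooth_on I y" "smooth_on I z" and pos: "\<And>s. s \<in> I \<Longrightarrow> y s > 0"
    and ode: "\<And>s. s \<in> I \<Longrightarrow> translator_ode (y s) (deriv y s) (deriv z s) (deriv (deriv y) s) (deriv (deriv z) s)"
    using t by (auto simp: translator_profile_def y_def z_def Let_def)
  note d = smooth_onD(1)[OF sm(1) I(1)] smooth_onD(1)[OF sm(2) I(1)]
    smooth_onD(1)[OF smooth_onD(2)[OF sm(1) I(1)] I(1)] smooth_onD(1)[OF smooth_onD(2)[OF sm(2) I(1)] I(1)]
  define p where "p = (\<lambda>s. deriv y s / (y s * deriv z s))"
  have dp: "(p has_real_derivative deriv z s * (1 + (p s)\<^sup>2)) (at s)" if s: "s \<in> I" for s
  proof -
    define a b a1 b1 a2 b2 where "a = y s" and "b = z s" and "a1 = deriv y s" and "b1 = deriv z s"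
      and "a2 = deriv (deriv y) s" and "b2 = deriv (deriv z) s"
    note ab = a_def b_def a1_def b1_def a2_def b2_def
    have a: "a > 0" and b1: "b1 \<noteq> 0" using pos z s by (auto simp: ab)
    have o: "b1 * (a2 * a - a1\<^sup>2) - a1 * b2 * a = (a1\<^sup>2 + b1\<^sup>2 * a\<^sup>2) * b1"
      using translator_odeD[OF ode[OF s] pos[OF s]] by (simp only: ab)
    have e: "(a1\<^sup>2 + b1\<^sup>2 * a\<^sup>2) * b1 / (a * b1)\<^sup>2 = b1 * (1 + (a1 / (a * b1))\<^sup>2)"
      using a b1 by (simp add: field_simps power2_eq_square)
    have "(p has_real_derivative (a2 * (a * b1) - a1 * (a1 * b1 + b2 * a)) / ((a * b1) * (a * b1))) (at s)"
      unfolding p_def ab using pos[OF s] z[OF s]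
      by (intro DERIV_divide DERIV_mult d s) auto
    also have "(a2 * (a * b1) - a1 * (a1 * b1 + b2 * a)) / ((a * b1) * (a * b1))
       = (b1 * (a2 * a - a1\<^sup>2) - a1 * b2 * a) / (a * b1)\<^sup>2"
      by (simp add: algebra_simps power2_eq_square)
    finally show ?thesis
      unfolding o e by (simp add: p_def ab)
  qed
  have da: "((\<lambda>s. arctan (p s) - z s) has_real_derivative 0) (at s)" if s: "s \<in> I" for s
  proof -
    have "1 + (p s)\<^sup>2 \<noteq> 0" by (smt (verit) zero_le_power2)
    then show ?thesis by (auto intro!: derivative_eq_intros dp d s simp: field_simps)
  qed
  obtain s0 where s0: "s0 \<in> I" using I by auto
  define a where "a = z s0 - arctan (p s0)"
  have a: "arctan (p s) = z s - a" if "s \<in> I" for s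
    using zero_derivative_const_on[OF I(2) da that s0] by (simp add: a_def)
  have c: "cos (z s - a) > 0" if "s \<in> I" for s
    using cos_gt_zero_pi[of "arctan (p s)"] arctan[of "p s"] a[OF that] by auto
  have dG: "((\<lambda>s. y s * cos (z s - a)) has_real_derivative 0) (at s)" if s: "s \<in> I" for s
  proof -
    have "tan (z s - a) = p s" using a[OF s] tan_arctan by metis
    then have "y s * deriv z s * sin (z s - a) = deriv y s * cos (z s - a)"
      using c[OF s] pos[OF s] z[OF s] by (simp add: tan_def p_def field_simps)
    then show ?thesis by (auto intro!: derivative_eq_intros d s simp: algebra_simps)
  qed
  show thesis
  proof (rule that)
    show "y s0 * cos (z s0 - a) > 0" using c pos s0 by simp
    fix s assume s: "s \<in> I"
    have "sin (z s - (a - pi/2)) = cos (z s - a)"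
      by (simp add: sin_diff cos_diff)
    then show "0 < z s - (a - pi/2) \<and> z s - (a - pi/2) < pi \<and> y s * sin (z s - (a - pi/2)) = y s0 * cos (z s0 - a)"
      using zero_derivative_const_on[OF I(2) dG s s0] arctan[of "p s"] a[OF s] by auto
  qed
qed

text \<open>Along the model curve \<open>(z - 2 c2)/2 = arctan (exp s)\<close>, which dictates the new parameter
  \<open>\<phi> = ln (tan h)\<close> with \<open>h = (z - d)/2\<close>. By the normal form \<open>\<phi>' = z' / sin (z - d) = y z' / C\<close>, so \<open>\<phi>\<close>
  is regular, and its smoothness needs only products.\<close>

lemma translator_grim_parameter:
  assumes I: "open I" "is_interval I" "I \<noteq> {}" and t: "translator_profile I \<alpha>"
    and z: "\<And>s. s \<in> I \<Longrightarrow> deriv (\<lambda>s. snd (\<alpha> s)) s \<noteq> 0"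
  obtains c1 c2 \<phi> where "c1 > 0" "smooth_on I \<phi>" "\<And>s. s \<in> I \<Longrightarrow> deriv \<phi> s \<noteq> 0" "inj_on \<phi> I"
    "\<And>s. s \<in> I \<Longrightarrow> \<alpha> s = grim_curve c1 c2 (\<phi> s)"
proof -
  define y z where "y = (\<lambda>s. fst (\<alpha> s))" and "z = (\<lambda>s. snd (\<alpha> s))"
  note z = z[folded z_def]
  have sm: "smooth_on I y" "smooth_on I z" and pos: "\<And>s. s \<in> I \<Longrightarrow> y s > 0"
    using t by (auto simp: translator_profile_def y_def z_def Let_def)
  obtain C d where C: "C > 0" and
    n: "\<And>s. s \<in> I \<Longrightarrow> 0 < z s - d \<and> z s - d < pi \<and> y s * sin (z s - d) = C"
    using translator_normal_form[OF I t] z unfolding y_def z_def by metis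
  define h where "h = (\<lambda>s. (z s - d) / 2)"
  have h: "0 < h s" "h s < pi/2" and sc: "sin (h s) > 0" "cos (h s) > 0"
    and yc: "y s * (2 * sin (h s) * cos (h s)) = C" if "s \<in> I" for s
  proof -
    show h: "0 < h s" "h s < pi/2" using n[OF that] by (auto simp: h_def)
    show "sin (h s) > 0" "cos (h s) > 0"
      using h by (auto intro: sin_gt_zero cos_gt_zero_pi)
    have "z s - d = 2 * h s" by (simp add: h_def)
    then show "y s * (2 * sin (h s) * cos (h s)) = C"
      using n[OF that] sin_double[of "h s"] by simp
  qed
  define \<phi> where "\<phi> = (\<lambda>s. ln (tan (h s)))"
  have tp: "tan (h s) > 0" if "s \<in> I" for s
    using sc[OF that] by (simp add: tan_def)
  have d\<phi>: "(\<phi> has_real_derivative (1 / C) * (y s * deriv z s)) (at s)" if s: "s \<in> I" for s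
  proof -
    have dh: "(h has_real_derivative deriv z s / 2) (at s)"
      unfolding h_def by (auto intro!: derivative_eq_intros smooth_onD(1)[OF sm(2) I(1) s])
    have "(\<phi> has_real_derivative 1 / tan (h s) * (inverse ((cos (h s))\<^sup>2) * (deriv z s / 2))) (at s)"
      unfolding \<phi>_def
      using tp[OF s] sc[OF s]
      by (intro DERIV_chain'[OF DERIV_chain'[OF dh DERIV_tan] DERIV_ln_divide]) auto
    also have "1 / tan (h s) * (inverse ((cos (h s))\<^sup>2) * (deriv z s / 2)) = (1 / C) * (y s * deriv z s)"
      unfolding yc[OF s, symmetric] using sc[OF s] pos[OF s]
      by (simp add: tan_def field_simps power2_eq_square)
    finally show ?thesis .
  qed
  have d0: "deriv \<phi> s \<noteq> 0" if "s \<in> I" for s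
    using DERIV_imp_deriv[OF d\<phi>[OF that]] C pos[OF that] z[OF that] by simp
  show thesis
  proof (rule that)
    show "C / 2 > 0" using C by simp
    show "smooth_on I \<phi>"
      using smooth_on_DERIV[OF I(1) d\<phi>]
        smooth_on_mult[OF I(1) smooth_on_const[OF I(1)] smooth_on_mult[OF I(1) sm(1) smooth_onD(2)[OF sm(2) I(1)]]]
      by blast
    show "deriv \<phi> s \<noteq> 0" if "s \<in> I" for s using d0[OF that] .
    show "inj_on \<phi> I"
      by (rule inj_on_nonzero_derivative[OF I(2) d\<phi>]) (use C pos z in force)+
    fix s assume s: "s \<in> I"
    have e: "exp (\<phi> s) = tan (h s)" using tp[OF s] by (simp add: \<phi>_def)
    have "C * cosh (\<phi> s) = C * (tan (h s) + inverse (tan (h s))) / 2"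
      by (simp add: cosh_def exp_minus e)
    also have "tan (h s) + inverse (tan (h s)) = ((sin (h s))\<^sup>2 + (cos (h s))\<^sup>2) / (sin (h s) * cos (h s))"
      using sc[OF s] by (simp add: tan_def field_simps power2_eq_square)
    also have "C * \<dots> / 2 = y s"
      unfolding yc[OF s, symmetric] using sc[OF s] by simp
    finally have "y s = C * cosh (\<phi> s)" by simp
    moreover have "arctan (exp (\<phi> s)) = h s"
      unfolding e using h[OF s] by (intro arctan_tan) auto
    ultimately show "\<alpha> s = grim_curve (C / 2) (d / 2) (\<phi> s)"
      by (simp add: grim_curve_def prod_eq_iff y_def z_def h_def)
  qed
qed

lemma deriv_eq_on_open:
  assumes "open I" "\<And>s. s \<in> I \<Longrightarrow> (f has_real_derivative f' s) (at s)"
    "\<And>s. s \<in> I \<Longrightarrow> (f' has_real_derivative f'' s) (at s)" "s \<in> I"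
  shows "deriv f s = f' s" "deriv (deriv f) s = f'' s"
proof -
  have e: "deriv f s = f' s" if "s \<in> I" for s
    using assms(2) that by (blast intro: DERIV_imp_deriv)
  then show "deriv f s = f' s" using assms(4) by blast
  have "(deriv f has_real_derivative f'' s) (at s)"
    by (rule has_field_derivative_transform_within_open[OF assms(3) assms(1)])
      (use assms(4) e in auto)
  then show "deriv (deriv f) s = f'' s" by (rule DERIV_imp_deriv)
qed

lemma translator_profileI:
  fixes I \<alpha> defines "y \<equiv> \<lambda>s. fst (\<alpha> s)" and "z \<equiv> \<lambda>s. snd (\<alpha> s)"
  assumes I: "open I"
    and y: "\<And>s. s \<in> I \<Longrightarrow> (y has_real_derivative y1 s) (at s)"
      "\<And>s. s \<in> I \<Longrightarrow> (y1 has_real_derivative y2 s) (at s)" "smooth_on I y1"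
    and z: "\<And>s. s \<in> I \<Longrightarrow> (z has_real_derivative z1 s) (at s)"
      "\<And>s. s \<in> I \<Longrightarrow> (z1 has_real_derivative z2 s) (at s)" "smooth_on I z1"
    and "\<And>s. s \<in> I \<Longrightarrow> y s > 0" "\<And>s. s \<in> I \<Longrightarrow> y1 s \<noteq> 0 \<or> z1 s \<noteq> 0"
      "\<And>s. s \<in> I \<Longrightarrow> translator_ode (y s) (y1 s) (z1 s) (y2 s) (z2 s)"
  shows "translator_profile I \<alpha>"
  using assms deriv_eq_on_open[OF I y(1,2)] deriv_eq_on_open[OF I z(1,2)]
    smooth_on_DERIV[OF I y(1,3)] smooth_on_DERIV[OF I z(1,3)]
  unfolding translator_profile_def Let_def by simp

lemma DERIV_cong_open:
  fixes f :: "real \<Rightarrow> real"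
  assumes "(f has_real_derivative d) (at s)" "open I" "s \<in> I" "\<And>x. x \<in> I \<Longrightarrow> f x = g x"
  shows "(g has_real_derivative d) (at s)"
  using has_field_derivative_transform_within_open assms by blast

lemma translator_profile_slice:
  assumes I: "open I" and \<phi>: "smooth_on I \<phi>" "\<And>s. s \<in> I \<Longrightarrow> deriv \<phi> s \<noteq> 0" "\<And>s. s \<in> I \<Longrightarrow> \<phi> s > 0"
    and \<alpha>: "\<And>s. s \<in> I \<Longrightarrow> \<alpha> s = slice_curve z0 (\<phi> s)"
  shows "translator_profile I \<alpha>"
proof (rule translator_profileI[OF I])
  note d = smooth_onD[OF \<phi>(1) I]
  fix s assume s: "s \<in> I"
  show "((\<lambda>s. fst (\<alpha> s)) has_real_derivative deriv \<phi> s) (at s)"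
    by (rule DERIV_cong_open[OF d(1) I]) (use s \<alpha> in \<open>auto simp: slice_curve_def\<close>)
  show "(deriv \<phi> has_real_derivative deriv (deriv \<phi>) s) (at s)"
    by (rule smooth_onD(1)[OF d(2) I s])
  show "((\<lambda>s. snd (\<alpha> s)) has_real_derivative 0) (at s)"
    by (rule DERIV_cong_open[OF DERIV_const I]) (use s \<alpha> in \<open>auto simp: slice_curve_def\<close>)
  show "((\<lambda>s. 0) has_real_derivative 0) (at s)" by simp
qed (use \<phi> \<alpha> I in \<open>auto simp: slice_curve_def translator_ode_def intro: smooth_on_const smooth_onD\<close>)

lemma DERIV_arctan_exp:
  assumes "(f has_real_derivative f') (at s)"
  shows "((\<lambda>s. arctan (exp (f s))) has_real_derivative f' / (2 * cosh (f s))) (at s)"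
proof -
  have "1 + exp (f s) * exp (f s) = exp (f s) * (2 * cosh (f s))"
    by (simp add: cosh_def exp_minus field_simps)
  then show ?thesis
    by (auto intro!: derivative_eq_intros assms simp: power2_eq_square divide_simps)
qed

text \<open>The equation is checked for every regular parametrization of the model curve, because maximality
  concerns all of them.\<close>

lemma translator_profile_grim:
  assumes I: "open I" and \<phi>: "smooth_on I \<phi>" "\<And>s. s \<in> I \<Longrightarrow> deriv \<phi> s \<noteq> 0" and c1: "c1 > 0"
    and \<alpha>: "\<And>s. s \<in> I \<Longrightarrow> \<alpha> s = grim_curve c1 c2 (\<phi> s)"
  shows "translator_profile I \<alpha>"
proof (rule translator_profileI[OF I])
  note d = smooth_onD[OF \<phi>(1) I]
  note d2 = smooth_onD[OF d(2) I]
  have sm: "smooth_on I (\<lambda>s. 2 * c1 * cosh (\<phi> s))"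
    by (intro smooth_on_mult smooth_on_const smooth_on_cosh I \<phi>)
  have e: "deriv (\<lambda>s. 2 * c1 * cosh (\<phi> s)) s = 2 * c1 * (sinh (\<phi> s) * deriv \<phi> s)" if "s \<in> I" for s
    by (rule DERIV_imp_deriv) (auto intro!: derivative_eq_intros d that)
  show "smooth_on I (\<lambda>s. 2 * c1 * (sinh (\<phi> s) * deriv \<phi> s))"
    by (rule smooth_on_cong[OF I smooth_onD(2)[OF sm I] e])
  show "smooth_on I (\<lambda>s. deriv \<phi> s * inverse (cosh (\<phi> s)))"
    by (intro smooth_on_mult smooth_on_inverse smooth_on_cosh I \<phi> d cosh_real_pos)
  fix s assume s: "s \<in> I"
  show "((\<lambda>s. fst (\<alpha> s)) has_real_derivative 2 * c1 * (sinh (\<phi> s) * deriv \<phi> s)) (at s)"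
    by (rule DERIV_cong_open[where f="\<lambda>s. 2 * c1 * cosh (\<phi> s)", OF _ I])
      (use s \<alpha> in \<open>auto simp: grim_curve_def intro!: derivative_eq_intros d\<close>)
  show "((\<lambda>s. 2 * c1 * (sinh (\<phi> s) * deriv \<phi> s)) has_real_derivative
     2 * c1 * (cosh (\<phi> s) * (deriv \<phi> s)\<^sup>2 + sinh (\<phi> s) * deriv (deriv \<phi>) s)) (at s)"
    by (auto intro!: derivative_eq_intros d d2 s simp: power2_eq_square algebra_simps)
  show "((\<lambda>s. snd (\<alpha> s)) has_real_derivative deriv \<phi> s * inverse (cosh (\<phi> s))) (at s)"
  proof (rule DERIV_cong_open[OF _ I s])
    have "((\<lambda>s. 2 * (c2 + arctan (exp (\<phi> s)))) has_real_derivative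
        2 * (0 + deriv \<phi> s / (2 * cosh (\<phi> s)))) (at s)"
      by (intro DERIV_cmult DERIV_add DERIV_const DERIV_arctan_exp d s)
    then show "((\<lambda>s. 2 * (c2 + arctan (exp (\<phi> s)))) has_real_derivative
        deriv \<phi> s * inverse (cosh (\<phi> s))) (at s)"
      by (simp add: field_simps)
  qed (use \<alpha> in \<open>simp add: grim_curve_def\<close>)
  show "((\<lambda>s. deriv \<phi> s * inverse (cosh (\<phi> s))) has_real_derivative
     deriv (deriv \<phi>) s / cosh (\<phi> s) - (deriv \<phi> s)\<^sup>2 * sinh (\<phi> s) / (cosh (\<phi> s))\<^sup>2) (at s)"
    using cosh_real_pos[of "\<phi> s"]
    by (auto intro!: derivative_eq_intros d d2 s simp: power2_eq_square field_simps)
  show "fst (\<alpha> s) > 0" using c1 s \<alpha> by (simp add: grim_curve_def)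
  show "2 * c1 * (sinh (\<phi> s) * deriv \<phi> s) \<noteq> 0 \<or> deriv \<phi> s * inverse (cosh (\<phi> s)) \<noteq> 0"
    using \<phi>(2)[OF s] cosh_real_pos[of "\<phi> s"] by auto
  define C S p q where "C = cosh (\<phi> s)" and "S = sinh (\<phi> s)" and "p = deriv \<phi> s" and "q = deriv (deriv \<phi>) s"
  have C: "C > 0" "C * C - S * S = 1"
    using cosh_square_eq[of "\<phi> s"] by (auto simp: C_def S_def power2_eq_square)
  have "p / C * (2 * c1 * (C * p\<^sup>2 + S * q) - (2 * c1 * (S * p))\<^sup>2 / (2 * c1 * C))
      - 2 * c1 * (S * p) * (q / C - p\<^sup>2 * S / C\<^sup>2) = 2 * c1 * p^3"
    using C(1) c1 by (simp add: field_simps power2_eq_square power3_eq_cube)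
  moreover have "((2 * c1 * (S * p))\<^sup>2 / (2 * c1 * C)\<^sup>2 + (p / C)\<^sup>2) * (2 * c1 * C) * (p / C)
      = 2 * c1 * p^3 * ((S * S + 1) / (C * C))"
    using C(1) c1 by (simp add: field_simps power2_eq_square power3_eq_cube)
  moreover have "(S * S + 1) / (C * C) = 1" using C by simp
  ultimately have "translator_ode (2 * c1 * C) (2 * c1 * (S * p)) (p / C)
      (2 * c1 * (C * p\<^sup>2 + S * q)) (q / C - p\<^sup>2 * S / C\<^sup>2)"
    unfolding translator_ode_def by (simp only: mult_1_right)
  moreover have f: "fst (\<alpha> s) = 2 * c1 * cosh (\<phi> s)"
    using s \<alpha> by (simp add: grim_curve_def)
  ultimately show "translator_ode (fst (\<alpha> s)) (2 * c1 * (sinh (\<phi> s) * deriv \<phi> s)) (deriv \<phi> s * inverse (cosh (\<phi> s)))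
     (2 * c1 * (cosh (\<phi> s) * (deriv \<phi> s)\<^sup>2 + sinh (\<phi> s) * deriv (deriv \<phi>) s))
     (deriv (deriv \<phi>) s / cosh (\<phi> s) - (deriv \<phi> s)\<^sup>2 * sinh (\<phi> s) / (cosh (\<phi> s))\<^sup>2)"
    unfolding f C_def S_def p_def q_def divide_inverse by simp
qed

section \<open>Maximal curves and their surfaces\<close>

lemma reparametrizes_same_surface:
  assumes "reparametrizes I \<alpha> J \<beta>"
  shows "Psi \<alpha> ` strip I = Psi \<beta> ` strip J"
proof -
  obtain \<phi> where \<phi>: "bij_betw \<phi> I J" "\<And>s. s \<in> I \<Longrightarrow> \<alpha> s = \<beta> (\<phi> s)"
    using assms by (auto simp: reparametrizes_def)
  have e: "Psi \<gamma> ` strip K = (\<Union>s\<in>K. range (\<lambda>t. vector [t, fst (\<gamma> s), snd (\<gamma> s)]))"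
    for \<gamma> :: "real \<Rightarrow> real \<times> real" and K
  proof safe
    fix u :: "real^2" assume "u \<in> strip K"
    then show "Psi \<gamma> u \<in> (\<Union>s\<in>K. range (\<lambda>t. vector [t, fst (\<gamma> s), snd (\<gamma> s)]))"
      by (auto simp: strip_def Psi_def)
  next
    fix s t assume "s \<in> K"
    then show "vector [t, fst (\<gamma> s), snd (\<gamma> s)] \<in> Psi \<gamma> ` strip K"
      by (intro image_eqI[where x="vector [s, t]"]) (auto simp: strip_def Psi_def vector_2)
  qed
  show ?thesis unfolding e bij_betw_imp_surj_on[OF \<phi>(1), symmetric] using \<phi>(2) by auto
qed

lemma reparametrizes_refl: "open I \<Longrightarrow> is_interval I \<Longrightarrow> reparametrizes I \<alpha> I \<alpha>"
  unfolding reparametrizes_def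
  by (intro conjI exI[of _ "\<lambda>x. x"]) (auto intro: smooth_on_ident simp: bij_betw_def)

lemma greaterThan_interval: "open {0::real<..}" "is_interval {0::real<..}"
  by (auto simp: is_interval_1)

lemma reaper_slice: "parabolic_h_grim_reaper {0<..} (slice_curve z0)"
proof -
  have "translator_profile {0<..} (slice_curve z0)"
    by (rule translator_profile_slice[where \<phi>="\<lambda>x. x"]) (auto intro: smooth_on_ident)
  then show ?thesis
    by (auto simp: parabolic_h_grim_reaper_iff is_interval_1 )
qed

lemma reaper_grim:
  assumes "c1 > 0"
  shows "parabolic_h_grim_reaper UNIV (grim_curve c1 c2)"
proof -
  have "translator_profile UNIV (grim_curve c1 c2)"
    by (rule translator_profile_grim[where \<phi>="\<lambda>x. x", OF _ _ _ assms]) (auto intro: smooth_on_ident)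
  then show ?thesis by (auto simp: parabolic_h_grim_reaper_iff)
qed

text \<open>A single horizontal tangent makes the whole curve horizontal, and then \<open>y\<close> itself is a regular
  parameter.\<close>

lemma slice_profile:
  fixes I \<alpha> defines "y \<equiv> \<lambda>s. fst (\<alpha> s)" and "z \<equiv> \<lambda>s. snd (\<alpha> s)"
  assumes I: "open I" "is_interval I" and t: "translator_profile I \<alpha>"
    and z: "s0 \<in> I" "deriv z s0 = 0"
  shows "smooth_on I y" "\<And>s. s \<in> I \<Longrightarrow> deriv y s \<noteq> 0" "inj_on y I"
    "\<And>s. s \<in> I \<Longrightarrow> y s > 0" "\<And>s. s \<in> I \<Longrightarrow> \<alpha> s = slice_curve (z s0) (y s)"
proof -
  show sm: "smooth_on I y" and pos: "\<And>s. s \<in> I \<Longrightarrow> y s > 0"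
    using t by (auto simp: translator_profile_def y_def z_def Let_def)
  have smz: "smooth_on I z" and reg: "\<And>s. s \<in> I \<Longrightarrow> deriv y s \<noteq> 0 \<or> deriv z s \<noteq> 0"
    using t by (auto simp: translator_profile_def y_def z_def Let_def)
  have z0: "deriv z s = 0" if "s \<in> I" for s
    using translator_first_integral[OF I t z(1) that] z(2) unfolding z_def by blast
  show y': "deriv y s \<noteq> 0" if "s \<in> I" for s using reg z0 that by auto
  show "inj_on y I"
    by (rule inj_on_nonzero_derivative[OF I(2) smooth_onD(1)[OF sm I(1)] y'])
  fix s assume s: "s \<in> I"
  have "(z has_real_derivative 0) (at r)" if "r \<in> I" for r
    using smooth_onD(1)[OF smz I(1) that] z0[OF that] by simp
  then have "z s = z s0"
    using zero_derivative_const_on[OF I(2)] s z(1) by blast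
  then show "\<alpha> s = slice_curve (z s0) (y s)"
    by (simp add: slice_curve_def prod_eq_iff y_def z_def)
qed

lemma maximalI:
  assumes "parabolic_h_grim_reaper I \<alpha>"
    and "\<And>J \<beta> \<phi>. parabolic_h_grim_reaper J \<beta> \<Longrightarrow> \<phi> ` I \<subseteq> J \<Longrightarrow> smooth_on I \<phi> \<Longrightarrow>
      (\<And>s. s \<in> I \<Longrightarrow> deriv \<phi> s \<noteq> 0) \<Longrightarrow> (\<And>s. s \<in> I \<Longrightarrow> \<alpha> s = \<beta> (\<phi> s)) \<Longrightarrow> J \<subseteq> \<phi> ` I"
  shows "maximal_parabolic_h_grim_reaper I \<alpha>"
  unfolding maximal_parabolic_h_grim_reaper_def
proof (intro conjI notI)
  assume "\<exists>J \<beta> J'. parabolic_h_grim_reaper J \<beta> \<and> J' \<subset> J \<and> reparametrizes I \<alpha> J' \<beta>"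
  then obtain J \<beta> J' \<phi> where J: "parabolic_h_grim_reaper J \<beta>" "J' \<subset> J" and
    \<phi>: "smooth_on I \<phi>" "\<And>s. s \<in> I \<Longrightarrow> deriv \<phi> s \<noteq> 0" "bij_betw \<phi> I J'" "\<And>s. s \<in> I \<Longrightarrow> \<alpha> s = \<beta> (\<phi> s)"
    unfolding reparametrizes_def by blast
  have "J \<subseteq> \<phi> ` I"
    using J \<phi> by (intro assms(2)[of J \<beta>]) (auto simp: bij_betw_def)
  then show False using J \<phi>(3) by (auto simp: bij_betw_def)
qed (rule assms)

text \<open>An extension is horizontal along the given piece, hence everywhere; then \<open>y\<close> is injective on it, but
  the given piece already takes all positive values of \<open>y\<close>.\<close>

lemma maximal_slice:
  assumes "reparametrizes I \<alpha> {0<..} (slice_curve z0)"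
  shows "maximal_parabolic_h_grim_reaper I \<alpha>"
proof -
  obtain \<psi> where I: "open I" "is_interval I" and \<psi>: "smooth_on I \<psi>" "\<And>s. s \<in> I \<Longrightarrow> deriv \<psi> s \<noteq> 0"
    "\<psi> ` I = {0<..}" "\<And>s. s \<in> I \<Longrightarrow> \<alpha> s = slice_curve z0 (\<psi> s)"
    using assms by (auto simp: reparametrizes_def bij_betw_def)
  have "1 \<in> \<psi> ` I" using \<psi>(3) by simp
  then have ne: "I \<noteq> {}" by blast
  have pos: "\<psi> s > 0" if "s \<in> I" for s using \<psi>(3) that by auto
  show ?thesis
  proof (rule maximalI)
    show "parabolic_h_grim_reaper I \<alpha>"
      unfolding parabolic_h_grim_reaper_iff
      using I ne translator_profile_slice[OF I(1) \<psi>(1,2) pos \<psi>(4)] by blast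
    fix J \<beta> \<phi>
    assume "parabolic_h_grim_reaper J \<beta>" and \<phi>: "\<phi> ` I \<subseteq> J" "smooth_on I \<phi>"
      "\<And>s. s \<in> I \<Longrightarrow> deriv \<phi> s \<noteq> 0" "\<And>s. s \<in> I \<Longrightarrow> \<alpha> s = \<beta> (\<phi> s)"
    then have J: "open J" "is_interval J" "translator_profile J \<beta>"
      by (auto simp: parabolic_h_grim_reaper_iff)
    obtain s0 where s0: "s0 \<in> I" using ne by auto
    have smz: "smooth_on J (\<lambda>r. snd (\<beta> r))"
      using J(3) by (simp add: translator_profile_def Let_def)
    have "((\<lambda>s. snd (\<beta> (\<phi> s))) has_real_derivative
        deriv \<phi> s0 * deriv (\<lambda>r. snd (\<beta> r)) (\<phi> s0)) (at s0)"
      using DERIV_chain'[OF smooth_onD(1)[OF \<phi>(2) I(1) s0] smooth_onD(1)[OF smz J(1)]] \<phi>(1) s0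
      by (auto simp: mult.commute)
    moreover have "((\<lambda>s. snd (\<beta> (\<phi> s))) has_real_derivative 0) (at s0)"
      by (rule DERIV_cong_open[OF DERIV_const I(1) s0, of z0])
        (use \<phi>(4) \<psi>(4) in \<open>metis slice_curve_def snd_conv\<close>)
    ultimately have "deriv (\<lambda>r. snd (\<beta> r)) (\<phi> s0) = 0"
      using \<phi>(3)[OF s0] DERIV_unique by fastforce
    note sl = slice_profile[OF J _ this]
    have \<phi>s0: "\<phi> s0 \<in> J" using \<phi>(1) s0 by auto
    show "J \<subseteq> \<phi> ` I"
    proof
      fix r assume r: "r \<in> J"
      then have "fst (\<beta> r) \<in> \<psi> ` I" using sl(4)[OF \<phi>s0] \<psi>(3) by auto
      then obtain s where s: "s \<in> I" "fst (\<beta> r) = \<psi> s" by auto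
      have "fst (\<beta> (\<phi> s)) = \<psi> s" using \<phi>(4)[OF s(1)] \<psi>(4)[OF s(1)] by (metis slice_curve_def fst_conv)
      then have "\<phi> s = r" using inj_onD[OF sl(3)[OF \<phi>s0]] s r \<phi>(1) by auto
      then show "r \<in> \<phi> ` I" using s by auto
    qed
  qed
qed

lemma range_arctan_exp: "range (\<lambda>t::real. c + arctan (exp t)) = {c<..<c + pi/2}"
proof safe
  fix x :: real assume "x \<in> {c<..<c + pi/2}"
  then have x: "0 < x - c" "x - c < pi/2" by auto
  then have "tan (x - c) > 0" by (rule tan_gt_zero)
  moreover have "arctan (tan (x - c)) = x - c" using x by (intro arctan_tan) auto
  ultimately show "x \<in> range (\<lambda>t. c + arctan (exp t))"
    by (intro image_eqI[where x="ln (tan (x - c))"]) auto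
qed (use arctan_ubound in \<open>auto simp: zero_less_arctan_iff\<close>)

text \<open>An extension is nowhere horizontal, hence a piece of some model curve with parameter \<open>\<eta>\<close>. The given
  curve has heights in all of an interval of length \<open>pi\<close>, which fixes the vertical position of that
  model; so \<open>\<eta>\<close> restricts to the given parameter, which is already onto, and \<open>\<eta>\<close> is injective.\<close>

lemma maximal_grim:
  assumes "reparametrizes I \<alpha> UNIV (grim_curve c1 c2)" "c1 > 0"
  shows "maximal_parabolic_h_grim_reaper I \<alpha>"
proof -
  obtain \<psi> where I: "open I" "is_interval I" and \<psi>: "smooth_on I \<psi>" "\<And>s. s \<in> I \<Longrightarrow> deriv \<psi> s \<noteq> 0"
    "\<psi> ` I = UNIV" "\<And>s. s \<in> I \<Longrightarrow> \<alpha> s = grim_curve c1 c2 (\<psi> s)"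
    using assms by (auto simp: reparametrizes_def bij_betw_def)
  have ne: "I \<noteq> {}" using \<psi>(3) by auto
  show ?thesis
  proof (rule maximalI)
    show "parabolic_h_grim_reaper I \<alpha>"
      unfolding parabolic_h_grim_reaper_iff
      using I ne translator_profile_grim[OF I(1) \<psi>(1,2) assms(2) \<psi>(4)] by blast
    fix J \<beta> \<phi>
    assume "parabolic_h_grim_reaper J \<beta>" and \<phi>: "\<phi> ` I \<subseteq> J" "smooth_on I \<phi>"
      "\<And>s. s \<in> I \<Longrightarrow> deriv \<phi> s \<noteq> 0" "\<And>s. s \<in> I \<Longrightarrow> \<alpha> s = \<beta> (\<phi> s)"
    then have J: "open J" "is_interval J" "J \<noteq> {}" "translator_profile J \<beta>"
      by (auto simp: parabolic_h_grim_reaper_iff)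
    have z: "snd (\<beta> (\<phi> s)) = 2 * (c2 + arctan (exp (\<psi> s)))" if "s \<in> I" for s
      using \<phi>(4)[OF that] \<psi>(4)[OF that] by (metis grim_curve_def scaleR_Pair snd_conv real_scaleR_def)
    have nz: "deriv (\<lambda>r. snd (\<beta> r)) r \<noteq> 0" if r: "r \<in> J" for r
    proof
      assume "deriv (\<lambda>r. snd (\<beta> r)) r = 0"
      note sl = slice_profile(5)[OF J(1,2,4) r this]
      have c: "snd (\<beta> (\<phi> s)) = snd (\<beta> r)" if "s \<in> I" for s
        using sl[of "\<phi> s"] \<phi>(1) that by (auto simp: slice_curve_def prod_eq_iff)
      \<comment> \<open>A constant height contradicts the two heights of the model at the parameters 0 and 1.\<close>
      have "0 \<in> \<psi> ` I" "1 \<in> \<psi> ` I" using \<psi>(3) by auto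
      then obtain s t where "s \<in> I" "\<psi> s = 0" "t \<in> I" "\<psi> t = 1" by (metis imageE)
      then have "arctan (exp 0) = arctan (exp (1::real))"
        using z[of s] z[of t] c[of s] c[of t] by auto
      then show False unfolding arctan_eq_iff by simp
    qed
    obtain d1 d2 \<eta> where \<eta>: "inj_on \<eta> J" "\<And>r. r \<in> J \<Longrightarrow> \<beta> r = grim_curve d1 d2 (\<eta> r)"
      using translator_grim_parameter[OF J nz] by metis
    have zz: "c2 + arctan (exp (\<psi> s)) = d2 + arctan (exp (\<eta> (\<phi> s)))" if "s \<in> I" for s
      using z[OF that] \<eta>(2)[of "\<phi> s"] \<phi>(1) that by (auto simp: grim_curve_def)
    \<comment> \<open>Both ranges are open intervals of the same length, so inclusion forces equality.\<close>
    have "range (\<lambda>t. c2 + arctan (exp t)) \<subseteq> range (\<lambda>t. d2 + arctan (exp t))"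
    proof safe
      fix t
      have "t \<in> \<psi> ` I" using \<psi>(3) by auto
      then show "c2 + arctan (exp t) \<in> range (\<lambda>t. d2 + arctan (exp t))"
        using zz by auto
    qed
    then have "c2 = d2"
      unfolding range_arctan_exp by (simp add: greaterThanLessThan_subseteq_greaterThanLessThan)
    then have eq: "\<eta> (\<phi> s) = \<psi> s" if "s \<in> I" for s
      using zz[OF that] by (simp add: arctan_eq_iff)
    show "J \<subseteq> \<phi> ` I"
    proof
      fix r assume r: "r \<in> J"
      have "\<eta> r \<in> \<psi> ` I" using \<psi>(3) by auto
      then obtain s where s: "s \<in> I" "\<eta> r = \<psi> s" by auto
      then have "\<eta> (\<phi> s) = \<eta> r" using eq by simp
      then have "\<phi> s = r" using inj_onD[OF \<eta>(1)] s r \<phi>(1) by auto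
      then show "r \<in> \<phi> ` I" using s by auto
    qed
  qed
qed

text \<open>Maximality turns an embedding into a model curve into a parametrization of the whole model.\<close>

lemma maximal_covers:
  assumes m: "maximal_parabolic_h_grim_reaper I \<alpha>" and J: "parabolic_h_grim_reaper J \<beta>"
    and \<phi>: "smooth_on I \<phi>" "\<And>s. s \<in> I \<Longrightarrow> deriv \<phi> s \<noteq> 0" "inj_on \<phi> I" "\<phi> ` I \<subseteq> J"
    "\<And>s. s \<in> I \<Longrightarrow> \<alpha> s = \<beta> (\<phi> s)"
  shows "reparametrizes I \<alpha> J \<beta>"
proof -
  have "open I" "is_interval I"
    using m by (auto simp: maximal_parabolic_h_grim_reaper_def parabolic_h_grim_reaper_def)
  then have r: "reparametrizes I \<alpha> (\<phi> ` I) \<beta>"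
    using \<phi> by (auto simp: reparametrizes_def bij_betw_def)
  then have "\<not> \<phi> ` I \<subset> J"
    using m J unfolding maximal_parabolic_h_grim_reaper_def by blast
  with \<phi>(4) r show ?thesis by (metis psubsetI)
qed

lemma maximal_parabolic_h_grim_reaper_iff:
  "maximal_parabolic_h_grim_reaper I \<alpha> \<longleftrightarrow>
      (\<exists>z0. reparametrizes I \<alpha> {0<..} (slice_curve z0)) \<or>
      (\<exists>c1 c2. c1 > 0 \<and> reparametrizes I \<alpha> UNIV (grim_curve c1 c2))" (is "_ \<longleftrightarrow> ?S \<or> ?G")
proof
  assume m: "maximal_parabolic_h_grim_reaper I \<alpha>"
  then have I: "open I" "is_interval I" "I \<noteq> {}" "translator_profile I \<alpha>"
    by (auto simp: maximal_parabolic_h_grim_reaper_def parabolic_h_grim_reaper_iff)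
  show "?S \<or> ?G"
  proof (cases "\<exists>s\<in>I. deriv (\<lambda>s. snd (\<alpha> s)) s = 0")
    case True
    then obtain s0 where "s0 \<in> I" "deriv (\<lambda>s. snd (\<alpha> s)) s0 = 0" by auto
    note sl = slice_profile[OF I(1,2,4) this]
    have "reparametrizes I \<alpha> {0<..} (slice_curve (snd (\<alpha> s0)))"
      by (rule maximal_covers[OF m reaper_slice sl(1,2,3) _ sl(5)]) (use sl(4) in auto)
    then show ?thesis by blast
  next
    case False
    then obtain c1 c2 \<phi> where c: "c1 > 0" "smooth_on I \<phi>" "\<And>s. s \<in> I \<Longrightarrow> deriv \<phi> s \<noteq> 0" "inj_on \<phi> I"
      "\<And>s. s \<in> I \<Longrightarrow> \<alpha> s = grim_curve c1 c2 (\<phi> s)"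
      using translator_grim_parameter[OF I] by metis
    have "reparametrizes I \<alpha> UNIV (grim_curve c1 c2)"
      by (rule maximal_covers[OF m reaper_grim[OF c(1)] c(2,3,4) _ c(5)]) auto
    then show ?thesis using c(1) by blast
  qed
qed (auto intro: maximal_slice maximal_grim)

lemma slice_eq_Psi: "slice z0 = Psi (slice_curve z0) ` strip {0<..}"
proof safe
  fix p assume "p \<in> slice z0"
  then show "p \<in> Psi (slice_curve z0) ` strip {0<..}"
    by (intro image_eqI[where x="vector [p $ 2, p $ 1]"])
      (auto simp: slice_def H2R_def strip_def Psi_def slice_curve_def vec_eq_iff forall_3 vector_2 vector_3)
qed (auto simp: slice_def H2R_def strip_def Psi_def slice_curve_def vector_3)

lemma maximal_surfaces:
  "{Psi \<alpha> ` strip I | I \<alpha>. maximal_parabolic_h_grim_reaper I \<alpha>} =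
      {slice z0 | z0. True} \<union> {grim_surface c1 c2 | c1 c2. c1 > 0}"
proof (intro equalityI subsetI)
  fix S assume "S \<in> {Psi \<alpha> ` strip I | I \<alpha>. maximal_parabolic_h_grim_reaper I \<alpha>}"
  then show "S \<in> {slice z0 | z0. True} \<union> {grim_surface c1 c2 | c1 c2. c1 > 0}"
    unfolding maximal_parabolic_h_grim_reaper_iff slice_eq_Psi grim_surface_def
    using reparametrizes_same_surface by blast
next
  fix S assume "S \<in> {slice z0 | z0. True} \<union> {grim_surface c1 c2 | c1 c2. c1 > 0}"
  moreover have "maximal_parabolic_h_grim_reaper {0<..} (slice_curve z0)" for z0
    by (rule maximal_slice[OF reparametrizes_refl[OF greaterThan_interval]])
  moreover have "maximal_parabolic_h_grim_reaper UNIV (grim_curve c1 c2)" if "c1 > 0" for c1 c2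
    by (rule maximal_grim[OF reparametrizes_refl that]) auto
  ultimately show "S \<in> {Psi \<alpha> ` strip I | I \<alpha>. maximal_parabolic_h_grim_reaper I \<alpha>}"
    unfolding slice_eq_Psi grim_surface_def by blast
qed

section \<open>Sheets and asymptotic slices\<close>

lemma sin_double_arctan_exp: "sin (2 * arctan (exp s)) = 1 / cosh (s::real)"
proof -
  have "1 + (exp s)\<^sup>2 = exp s * (2 * cosh s)"
    by (simp add: cosh_def exp_minus field_simps power2_eq_square)
  moreover have "0 < 1 + (exp s)\<^sup>2" by (simp add: add_pos_nonneg)
  ultimately show ?thesis
    unfolding sin_double sin_arctan cos_arctan by (simp add: field_simps)
qed

text \<open>This implicit equation, from \<open>sin (2 arctan (exp s)) = 1 / cosh s\<close>, eliminates the parameter.\<close>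

lemma grim_surface_eq:
  assumes "c1 > 0"
  shows "grim_surface c1 c2 = {p. 2 * c2 < p $ 3 \<and> p $ 3 < 2 * c2 + pi \<and> p $ 2 * sin (p $ 3 - 2 * c2) = 2 * c1}"
proof (intro equalityI subsetI)
  fix p assume "p \<in> grim_surface c1 c2"
  then obtain u where "p = Psi (grim_curve c1 c2) u"
    by (auto simp: grim_surface_def)
  moreover define s where "s = u $ 1"
  ultimately have p: "p $ 2 = 2 * c1 * cosh s" "p $ 3 = 2 * c2 + 2 * arctan (exp s)"
    by (simp_all add: Psi_def grim_curve_def vector_3)
  have "arctan (exp s) < pi / 2" "arctan (exp s) > 0"
    using arctan_ubound by (auto simp: zero_less_arctan_iff)
  then show "p \<in> {p. 2 * c2 < p $ 3 \<and> p $ 3 < 2 * c2 + pi \<and> p $ 2 * sin (p $ 3 - 2 * c2) = 2 * c1}"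
    by (auto simp: p sin_double_arctan_exp)
next
  fix p :: "real^3"
  assume p: "p \<in> {p. 2 * c2 < p $ 3 \<and> p $ 3 < 2 * c2 + pi \<and> p $ 2 * sin (p $ 3 - 2 * c2) = 2 * c1}"
  have "p $ 3 / 2 \<in> range (\<lambda>t. c2 + arctan (exp t))"
    unfolding range_arctan_exp using p by auto
  then obtain s where s: "p $ 3 = 2 * c2 + 2 * arctan (exp s)" by auto
  then have "p $ 2 = 2 * c1 * cosh s"
    using p by (simp add: sin_double_arctan_exp field_simps)
  with s show "p \<in> grim_surface c1 c2"
    unfolding grim_surface_def
    by (intro image_eqI[where x="vector [s, p $ 1]"])
      (auto simp: strip_def Psi_def grim_curve_def vec_eq_iff forall_3 vector_2 vector_3)
qed

lemma closure_upper: "closure {w::real^2. w $ 2 > c} = {w. w $ 2 \<ge> c}"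
  and frontier_upper: "frontier {w::real^2. w $ 2 > c} = {w. w $ 2 = c}"
  and open_upper: "open {w::real^2. w $ 2 > c}"
  and connected_upper: "connected {w::real^2. w $ 2 > c}"
proof -
  have e: "w $ 2 = axis 2 1 \<bullet> w" for w :: "real^2" by (simp add: inner_axis')
  have a: "axis 2 1 \<noteq> (0 :: real^2)" by (simp add: axis_eq_0_iff)
  show "closure {w::real^2. w $ 2 > c} = {w. w $ 2 \<ge> c}"
    unfolding e using closure_halfspace_gt[OF a] by simp
  show "frontier {w::real^2. w $ 2 > c} = {w. w $ 2 = c}"
    unfolding e using frontier_halfspace_gt[of "axis 2 1 :: real^2"] a by simp
  show "open {w::real^2. w $ 2 > c}"
    by (rule open_halfspace_component_gt_cart)
  show "connected {w::real^2. w $ 2 > c}"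
    unfolding e by (intro convex_connected convex_halfspace_gt)
qed

lemma graph_over_eq: "graph_over D f = {p. (vector [p $ 1, p $ 2] :: real^2) \<in> D \<and> p $ 3 = f (vector [p $ 1, p $ 2])}"
proof -
  have v: "vector [w $ 1, w $ 2] = w" for w :: "real^2"
    by (simp add: vec_eq_iff forall_2 vector_2)
  show ?thesis unfolding graph_over_def
    by (force simp: image_iff vec_eq_iff[where ?'b=3] forall_3 vector_3 v)
qed

lemma smooth_on_arcsin_divide:
  assumes "c > 0"
  shows "smooth_on {c<..} (\<lambda>y. arcsin (c / y))"
proof (rule smooth_on_DERIV)
  fix y assume "y \<in> {c<..}"
  then have y: "y > c" by simp
  have "1 - (c / y)\<^sup>2 = (y * y + - (c * c)) / (y * y)"
    using y assms by (simp add: field_simps power2_eq_square)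
  then have s: "sqrt (1 - (c / y)\<^sup>2) = sqrt (y * y + - (c * c)) / y"
    using y assms by (simp add: real_sqrt_divide)
  have "((\<lambda>y. c / y) has_real_derivative - c / (y * y)) (at y)"
    using y assms by (auto intro!: derivative_eq_intros)
  then have "((\<lambda>y. arcsin (c / y)) has_real_derivative - c / (y * y) * inverse (sqrt (1 - (c / y)\<^sup>2))) (at y)"
    using y assms
    by (intro DERIV_chain2[OF DERIV_arcsin, THEN DERIV_cong]) (auto simp: field_simps)
  then show "((\<lambda>y. arcsin (c / y)) has_real_derivative
      - c * (inverse y * inverse (sqrt (y * y + - (c * c))))) (at y)"
    unfolding s using y assms by (simp add: field_simps)
next
  have "c * c < y * y" if "y > c" for y
    using that assms by (intro mult_strict_mono) auto
  then show "smooth_on {c<..} (\<lambda>y. - c * (inverse y * inverse (sqrt (y * y + - (c * c)))))"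
    using assms
    by (intro smooth_on_mult smooth_on_const smooth_on_inverse smooth_on_inverse_sqrt smooth_on_add
        smooth_on_ident open_greaterThan) auto
qed simp

text \<open>On \<open>(0, pi)\<close> the sine takes every value in \<open>(0, 1)\<close> twice, symmetrically about \<open>pi/2\<close>: these two
  preimages are the two sheets.\<close>

lemma arcsin_sheet_iff:
  assumes "0 < c" "0 < \<theta>" "\<theta> < pi"
  shows "c \<le> y \<and> (\<theta> = arcsin (c / y) \<or> \<theta> = pi - arcsin (c / y)) \<longleftrightarrow> y * sin \<theta> = c"
proof
  assume *: "c \<le> y \<and> (\<theta> = arcsin (c / y) \<or> \<theta> = pi - arcsin (c / y))"
  then have "-1 \<le> c / y" "c / y \<le> 1" using assms
    by (auto simp: divide_simps)
  then have "sin \<theta> = c / y" using * by auto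
  then show "y * sin \<theta> = c" using * assms by auto
next
  assume y: "y * sin \<theta> = c"
  have sp: "sin \<theta> > 0" using assms by (intro sin_gt_zero)
  then have y': "sin \<theta> = c / y" "y > 0"
    using y assms by (auto simp: field_simps zero_less_mult_iff)
  have "c \<le> y" using y sin_le_one[of \<theta>] y'(2) by (metis mult.right_neutral mult_left_mono less_imp_le)
  moreover have "\<theta> = arcsin (c / y) \<or> \<theta> = pi - arcsin (c / y)"
  proof (cases "\<theta> \<le> pi/2")
    case True
    then show ?thesis using arcsin_sin[of \<theta>] assms y'(1) by auto
  next
    case False
    then show ?thesis using arcsin_sin[of "pi - \<theta>"] assms y'(1) by auto
  qed
  ultimately show "c \<le> y \<and> (\<theta> = arcsin (c / y) \<or> \<theta> = pi - arcsin (c / y))" by blast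
qed

lemma arcsin_divide_bounds:
  assumes "0 < c" "c \<le> y"
  shows "0 < arcsin (c / y)" "arcsin (c / y) \<le> pi/2" "arcsin (c / y) = pi/2 \<longleftrightarrow> y = c"
proof -
  have b: "0 < c / y" "c / y \<le> 1" using assms by auto
  then show "0 < arcsin (c / y)" using arcsin_less_arcsin[of 0 "c / y"] by simp
  show "arcsin (c / y) \<le> pi/2" using b by (intro arcsin_ubound) auto
  show "arcsin (c / y) = pi/2 \<longleftrightarrow> y = c"
  proof
    assume "arcsin (c / y) = pi/2"
    moreover have "sin (arcsin (c / y)) = c / y" using b by (intro sin_arcsin) auto
    ultimately have "c / y = 1" by (metis sin_pi_half)
    then show "y = c" by (auto simp: divide_eq_1_iff)
  qed (use assms in auto)
qed

context
  fixes c1 c2 :: real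
  assumes c1: "c1 > 0"
begin

definition lower_sheet :: "real^2 \<Rightarrow> real" where
  "lower_sheet w = 2 * c2 + arcsin (2 * c1 / w $ 2)"

definition upper_sheet :: "real^2 \<Rightarrow> real" where
  "upper_sheet w = 2 * c2 + pi + - 1 * arcsin (2 * c1 / w $ 2)"

lemma grim_surface_sheets:
  "grim_surface c1 c2 = graph_over {w. w $ 2 \<ge> 2 * c1} lower_sheet \<union> graph_over {w. w $ 2 \<ge> 2 * c1} upper_sheet"
  (is "?L = ?R")
proof (rule set_eqI)
  fix p :: "real^3"
  have R: "p \<in> ?R \<longleftrightarrow> 2 * c1 \<le> p $ 2 \<and>
     (p $ 3 - 2 * c2 = arcsin (2 * c1 / p $ 2) \<or> p $ 3 - 2 * c2 = pi - arcsin (2 * c1 / p $ 2))"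
    by (auto simp: graph_over_eq lower_sheet_def upper_sheet_def vector_2)
  have "0 < p $ 3 - 2 * c2 \<and> p $ 3 - 2 * c2 < pi" if "p \<in> ?R"
  proof -
    have "0 < arcsin (2 * c1 / p $ 2)" "arcsin (2 * c1 / p $ 2) \<le> pi/2"
      using arcsin_divide_bounds(1,2)[of "2 * c1" "p $ 2"] c1 that unfolding R by auto
    with that pi_gt_zero show ?thesis unfolding R by linarith
  qed
  moreover have "p \<in> ?L \<Longrightarrow> 0 < p $ 3 - 2 * c2 \<and> p $ 3 - 2 * c2 < pi"
    by (auto simp: grim_surface_eq[OF c1])
  ultimately show "p \<in> ?L \<longleftrightarrow> p \<in> ?R"
    using arcsin_sheet_iff[of "2 * c1" "p $ 3 - 2 * c2" "p $ 2"] c1 R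
    by (auto simp: grim_surface_eq[OF c1])
qed

lemma smooth_sheets:
  "smooth_on {w. w $ 2 > 2 * c1} lower_sheet" "smooth_on {w. w $ 2 > 2 * c1} upper_sheet"
proof -
  have "smooth_on {w::real^2. w $ 2 > 2 * c1} (\<lambda>w. arcsin (2 * c1 / w $ 2))"
    by (rule smooth_on_comp_linear[OF _ open_upper _ smooth_on_arcsin_divide[of "2 * c1"]])
      (use c1 in \<open>auto intro: bounded_linear_vec_nth\<close>)
  then show "smooth_on {w. w $ 2 > 2 * c1} lower_sheet" "smooth_on {w. w $ 2 > 2 * c1} upper_sheet"
    unfolding lower_sheet_def[abs_def] upper_sheet_def[abs_def]
    using smooth_on_add[OF open_upper smooth_on_const[OF open_upper]]
      smooth_on_mult[OF open_upper smooth_on_const[OF open_upper, where c="-1 :: real"]] by blast+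
qed

lemma continuous_sheets:
  "continuous_on {w. w $ 2 \<ge> 2 * c1} lower_sheet" "continuous_on {w. w $ 2 \<ge> 2 * c1} upper_sheet"
proof -
  have "continuous_on {w::real^2. w $ 2 \<ge> 2 * c1} (\<lambda>w. arcsin (2 * c1 / w $ 2))"
  proof (intro continuous_intros ballI)
    fix w :: "real^2" assume w: "w \<in> {w. w $ 2 \<ge> 2 * c1}"
    then show "w $ 2 \<noteq> 0" using c1 by auto
    have "0 \<le> 2 * c1 / w $ 2" "2 * c1 / w $ 2 \<le> 1" using w c1 by auto
    then show "- 1 \<le> 2 * c1 / w $ 2 \<and> 2 * c1 / w $ 2 \<le> 1" by linarith
  qed
  then show "continuous_on {w. w $ 2 \<ge> 2 * c1} lower_sheet" "continuous_on {w. w $ 2 \<ge> 2 * c1} upper_sheet"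
    unfolding lower_sheet_def[abs_def] upper_sheet_def[abs_def]
    by (auto intro!: continuous_on_add continuous_on_diff)
qed

text \<open>Both sheets have the domain \<open>y > 2 c1\<close>; they meet where \<open>arcsin (2 c1 / y) = pi/2\<close>, that is, on the
  boundary horocycle \<open>y = 2 c1\<close>.\<close>

lemma bi_graph_grim_surface: "bi_graph (grim_surface c1 c2)"
proof -
  let ?D = "{w::real^2. w $ 2 > 2 * c1}"
  have cl: "closure ?D \<inter> halfplane = {w. w $ 2 \<ge> 2 * c1}"
    and fr: "frontier ?D \<inter> halfplane = {w. w $ 2 = 2 * c1}"
    unfolding closure_upper frontier_upper using c1 by (auto simp: halfplane_def)
  have sub: "?D \<subseteq> halfplane" using c1 by (auto simp: halfplane_def)
  have v: "(vector [0, a] :: real^2) $ 2 = a" for a :: real by (simp add: vector_2)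
  have ne: "?D \<noteq> {}" "{w::real^2. w $ 2 = 2 * c1} \<noteq> {}"
    using v[of "2 * c1 + 1"] v[of "2 * c1"] by (metis (mono_tags, lifting) empty_iff mem_Collect_eq less_add_one)+
  have b: "arcsin (2 * c1 / y) = pi - arcsin (2 * c1 / y) \<longleftrightarrow> y = 2 * c1" if "2 * c1 \<le> y" for y
  proof -
    have "x = pi - x \<longleftrightarrow> x = pi / 2" for x by auto
    then show ?thesis using arcsin_divide_bounds(3)[of "2 * c1" y] c1 that by simp
  qed
  then have b': "pi = 2 * arcsin (2 * c1 / y) \<longleftrightarrow> y = 2 * c1" if "2 * c1 \<le> y" for y
    using that by fastforce
  have i: "graph_over {w. w $ 2 \<ge> 2 * c1} lower_sheet \<inter> graph_over {w. w $ 2 \<ge> 2 * c1} upper_sheet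
      = graph_over {w. w $ 2 = 2 * c1} lower_sheet"
    using b b' c1 by (auto simp: graph_over_eq lower_sheet_def upper_sheet_def vector_2)
  have f: "graph_over {w. w $ 2 = 2 * c1} lower_sheet = graph_over {w. w $ 2 = 2 * c1} upper_sheet"
    using c1 by (auto simp: graph_over_eq lower_sheet_def upper_sheet_def vector_2)
  show ?thesis
    unfolding bi_graph_def
    by (rule exI[of _ ?D], rule exI[of _ ?D], rule exI[of _ lower_sheet], rule exI[of _ upper_sheet])
      (use sub ne i f smooth_sheets continuous_sheets grim_surface_sheets open_upper[of "2 * c1"]
        connected_upper[of "2 * c1"] in \<open>simp add: cl fr del: closure_halfspace_component_gt\<close>)
qed

text \<open>As \<open>y\<close> tends to infinity, \<open>arcsin (2 c1 / y)\<close> tends to zero, so the lower sheet approaches height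
  \<open>2 c2\<close> and the upper one height \<open>2 c2 + pi\<close>.\<close>

lemma asymptotic_grim_surface:
  "asymptotic_to_slice (grim_surface c1 c2) (2 * c2)"
  "asymptotic_to_slice (grim_surface c1 c2) (2 * c2 + pi)"
proof -
  have "((\<lambda>y. arcsin (2 * c1 / y)) \<longlongrightarrow> arcsin 0) at_top"
    by (rule isCont_tendsto_compose[OF isCont_arcsin])
      (auto intro!: tendsto_divide_0[OF tendsto_const] filterlim_at_top_imp_at_infinity filterlim_ident)
  then have *: "\<exists>b. \<forall>y\<ge>b. \<bar>arcsin (2 * c1 / y)\<bar> < \<epsilon>" if "\<epsilon> > 0" for \<epsilon>
    using tendstoD[OF _ that] by (fastforce simp: eventually_at_top_linorder dist_real_def)
  have sub: "graph_over {w. w $ 2 > 2 * c1} f \<subseteq> graph_over {w. w $ 2 \<ge> 2 * c1} f" for f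
    by (auto simp: graph_over_def)
  have "asymptotic_to_slice (grim_surface c1 c2) z"
    if "f = lower_sheet \<and> z = 2 * c2 \<or> f = upper_sheet \<and> z = 2 * c2 + pi" for f z
    unfolding asymptotic_to_slice_def
  proof (rule exI[of _ "2 * c1"], rule conjI[OF _ exI[of _ f]], goal_cases)
    case 1
    show "0 < 2 * c1" using c1 by simp
  next
    case 2
    show ?case
    proof (intro conjI allI impI)
      show "graph_over {w. w $ 2 > 2 * c1} f \<subseteq> grim_surface c1 c2"
        unfolding grim_surface_sheets using sub that by blast
      fix \<epsilon> :: real assume "\<epsilon> > 0"
      then obtain b where b: "\<And>y. y \<ge> b \<Longrightarrow> \<bar>arcsin (2 * c1 / y)\<bar> < \<epsilon>" using * by blast
      have "\<bar>f w - z\<bar> = \<bar>arcsin (2 * c1 / w $ 2)\<bar>" for w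
        using that by (auto simp: lower_sheet_def upper_sheet_def)
      then show "\<exists>b. \<forall>w. 2 * c1 < w $ 2 \<and> b < w $ 2 \<longrightarrow> \<bar>f w - z\<bar> < \<epsilon>"
        using b by (intro exI[of _ b]) auto
    qed
  qed
  then show "asymptotic_to_slice (grim_surface c1 c2) (2 * c2)"
    "asymptotic_to_slice (grim_surface c1 c2) (2 * c2 + pi)" by blast+
qed

lemma grim_surface_between_slices:
  "grim_surface c1 c2 \<subseteq> {p \<in> H2R. 2 * c2 < p $ 3 \<and> p $ 3 < 2 * c2 + pi}"
proof
  fix p assume p: "p \<in> grim_surface c1 c2"
  then have "2 * c1 \<le> p $ 2"
    unfolding grim_surface_sheets by (auto simp: graph_over_eq vector_2)
  then show "p \<in> {p \<in> H2R. 2 * c2 < p $ 3 \<and> p $ 3 < 2 * c2 + pi}"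
    using p c1 by (auto simp: grim_surface_eq[OF c1] H2R_def)
qed

end

theorem theorem6p2:
  "(\<forall>I \<alpha>. maximal_parabolic_h_grim_reaper I \<alpha> \<longleftrightarrow>
      (\<exists>z0. reparametrizes I \<alpha> {0<..} (slice_curve z0)) \<or>
      (\<exists>c1 c2. c1 > 0 \<and> reparametrizes I \<alpha> UNIV (grim_curve c1 c2))) \<and>
   {Psi \<alpha> ` strip I | I \<alpha>. maximal_parabolic_h_grim_reaper I \<alpha>} =
      {slice z0 | z0. True} \<union> {grim_surface c1 c2 | c1 c2. c1 > 0} \<and>
   (\<forall>c1 c2. c1 > 0 \<longrightarrow>
      bi_graph (grim_surface c1 c2) \<and>
      (\<exists>z1 z2. z1 < z2 \<and>
         grim_surface c1 c2 \<subseteq> {p \<in> H2R. z1 < p $ 3 \<and> p $ 3 < z2} \<and>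
         asymptotic_to_slice (grim_surface c1 c2) z1 \<and>
         asymptotic_to_slice (grim_surface c1 c2) z2))"
proof (intro conjI allI impI)
  fix c1 c2 :: real assume c1: "c1 > 0"
  show "bi_graph (grim_surface c1 c2)" by (rule bi_graph_grim_surface[OF c1])
  show "\<exists>z1 z2. z1 < z2 \<and>
      grim_surface c1 c2 \<subseteq> {p \<in> H2R. z1 < p $ 3 \<and> p $ 3 < z2} \<and>
      asymptotic_to_slice (grim_surface c1 c2) z1 \<and> asymptotic_to_slice (grim_surface c1 c2) z2"
    using grim_surface_between_slices[OF c1] asymptotic_grim_surface[OF c1]
    by (intro exI[of _ "2 * c2"] exI[of _ "2 * c2 + pi"]) auto
qed (rule maximal_parabolic_h_grim_reaper_iff maximal_surfaces)+

end
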